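(* Let $u$ be a minimizer of $\mathfrak{F}(v)=\int_\Omega F(X,v,\nabla v)\,dX$ over $W^{1,p}_\phi(\Omega)$. Within the open set $\{u>0\}$, $u$ satisfies $$\operatorname{div}\left(\mathcal{A}(X,\nabla u)\right)=m f(X)u^{m-1}$$ in the distributional sense.
   Context: Setting. $\Omega\subset\mathbb{R}^n$ is a bounded smooth domain, $2\le p<n$, and $\phi\in W^{1,p}(\Omega)$ is a bounded nonnegative function. $W^{1,p}_\phi(\Omega)$ is the set of functions in $W^{1,p}(\Omega)$ with trace value $\phi$ on $\partial\Omega$. The kernel $F:\Omega\times\mathbb{R}\times\mathbb{R}^n\to\mathbb{R}$ has the form $F(X,u,\xi)=G(X,\xi)+g(X,u)$, where: (1) for all $\xi\in\mathbb{R}^n$ the map $X\mapsto G(X,\xi)$ is continuous; (2) there is $\lambda>0$ with $\lambda|\xi|^p\le G(X,\xi)\le\lambda^{-1}|\xi|^p$; (3) for almost all $X\in\Omega$ the map $\xi\mapsto G(X,\xi)$ is strictly convex, differentiable, and $G(X,t\xi)=|t|^pG(X,\xi)$ for all $t\in\mathbb{R}$, $\xi\in\mathbb{R}^n$; (4) $g(X,u)=f(X)(u^+)^m+Q(X)\chi_{\{u>0\}}$ with $1\le m<p$, $f$ measurable with $-K\le f\le K$ for some $K>0$, and $Q\in C^{0,\beta}$ with $0<\epsilon<Q<\epsilon^{-1}$ for some $\epsilon>0$. A minimizer of $\mathfrak{F}$ is $u\in W^{1,p}_\phi(\Omega)$ with $\mathfrak{F}(u)\le\mathfrak{F}(v)$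 for all $v\in W^{1,p}_\phi(\Omega)$. Minimizers are nonnegative and have a continuous representative in $\Omega$, with which $u$ is identified; in particular $\{u>0\}$ is open. Notation: $\mathcal{A}(X,\xi):=\nabla_\xi G(X,\xi)$. *)

theory Defs
  imports "HOL-Analysis.Analysis"
begin

section \<open>Smooth functions and smooth domains\<close>

text \<open>The gradient as a vector; meaningful where \<open>f\<close> is differentiable.\<close>

definition grad :: "('a::euclidean_space \<Rightarrow> real) \<Rightarrow> 'a \<Rightarrow> 'a" where
  "grad f x = (THE D. GDERIV f x :> D)"

fun C_k :: "nat \<Rightarrow> ('a::euclidean_space \<Rightarrow> real) \<Rightarrow> bool" where
  "C_k 0 f \<longleftrightarrow> continuous_on UNIV f"
| "C_k (Suc k) f \<longleftrightarrow> (\<forall>x. f differentiable (at x)) \<and> (\<forall>b\<in>Basis. C_k k (\<lambda>x. grad f x \<bullet> b))"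

definition smooth :: "('a::euclidean_space \<Rightarrow> real) \<Rightarrow> bool" where
  "smooth f \<longleftrightarrow> (\<forall>k. C_k k f)"

text \<open>\<open>C\<^sub>c\<^sup>\<infinity>(\<Omega>)\<close>, the test functions being extended by zero to the whole space.\<close>

definition test_functions :: "'a::euclidean_space set \<Rightarrow> ('a \<Rightarrow> real) set" where
  "test_functions \<Omega> = {\<psi>. smooth \<psi> \<and> compact (closure {x. \<psi> x \<noteq> 0}) \<and> closure {x. \<psi> x \<noteq> 0} \<subseteq> \<Omega>}"

text \<open>
  Near each boundary point the domain is the open region above the graph of a smooth function
  over a hyperplane \<open>e\<^sup>\<bottom>\<close>; here \<open>x - (x \<bullet> e) *\<^sub>R e\<close> is the projection of \<open>x\<close>
  to that hyperplane and \<open>x \<bullet> e\<close> its height.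
\<close>

definition smooth_boundary :: "'a::euclidean_space set \<Rightarrow> bool" where
  "smooth_boundary \<Omega> \<longleftrightarrow> (\<forall>x\<^sub>0\<in>frontier \<Omega>. \<exists>r>0. \<exists>e \<gamma>. norm e = 1 \<and> smooth \<gamma> \<and>
     \<Omega> \<inter> ball x\<^sub>0 r = {x \<in> ball x\<^sub>0 r. \<gamma> (x - (x \<bullet> e) *\<^sub>R e) < x \<bullet> e})"

definition bounded_smooth_domain :: "'a::euclidean_space set \<Rightarrow> bool" where
  "bounded_smooth_domain \<Omega> \<longleftrightarrow>
     open \<Omega> \<and> connected \<Omega> \<and> \<Omega> \<noteq> {} \<and> bounded \<Omega> \<and> smooth_boundary \<Omega>"

section \<open>Sobolev functions\<close>

definition locally_integrable :: "'a::euclidean_space set \<Rightarrow> ('a \<Rightarrow> 'b::euclidean_space) \<Rightarrow> bool" where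
  "locally_integrable U h \<longleftrightarrow> (\<forall>K. compact K \<and> K \<subseteq> U \<longrightarrow> h absolutely_integrable_on K)"

definition in_Lp :: "'a::euclidean_space set \<Rightarrow> real \<Rightarrow> ('a \<Rightarrow> 'b::euclidean_space) \<Rightarrow> bool" where
  "in_Lp \<Omega> p h \<longleftrightarrow> h \<in> borel_measurable (lebesgue_on \<Omega>) \<and>
     integrable (lebesgue_on \<Omega>) (\<lambda>x. norm (h x) powr p)"

definition has_weak_gradient ::
  "'a::euclidean_space set \<Rightarrow> ('a \<Rightarrow> real) \<Rightarrow> ('a \<Rightarrow> 'a) \<Rightarrow> bool" where
  "has_weak_gradient \<Omega> u Du \<longleftrightarrow> locally_integrable \<Omega> u \<and> locally_integrable \<Omega> Du \<and>
     (\<forall>\<psi>\<in>test_functions \<Omega>.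
        (\<integral>x. u x *\<^sub>R grad \<psi> x \<partial>lebesgue_on \<Omega>) = - (\<integral>x. \<psi> x *\<^sub>R Du x \<partial>lebesgue_on \<Omega>))"

text \<open>
  A weak gradient is unique up to null sets, and \<open>wgrad\<close> picks one representative. Below it
  is used only under integrals, where the choice does not matter.
\<close>

definition wgrad :: "'a::euclidean_space set \<Rightarrow> ('a \<Rightarrow> real) \<Rightarrow> 'a \<Rightarrow> 'a" where
  "wgrad \<Omega> u = (SOME Du. has_weak_gradient \<Omega> u Du)"

definition W1p :: "'a::euclidean_space set \<Rightarrow> real \<Rightarrow> ('a \<Rightarrow> real) set" where
  "W1p \<Omega> p = {u. in_Lp \<Omega> p u \<and> (\<exists>Du. has_weak_gradient \<Omega> u Du) \<and> in_Lp \<Omega> p (wgrad \<Omega> u)}"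

section \<open>Boundary traces\<close>

text \<open>
  The \<open>s\<close>-dimensional Hausdorff measure, normalised to agree with surface area;
  \<^const>\<open>diameter\<close> is only meaningful on bounded sets. The outer measure is countably
  additive on Borel sets, so \<^const>\<open>measure_of\<close> does not degenerate.
\<close>

definition hausdorff_outer :: "real \<Rightarrow> 'a::euclidean_space set \<Rightarrow> ennreal" where
  "hausdorff_outer s A = (SUP \<delta>\<in>{0<..}.
     INF C\<in>{C :: nat \<Rightarrow> 'a set. A \<subseteq> (\<Union>i. C i) \<and> (\<forall>i. bounded (C i) \<and> diameter (C i) \<le> \<delta>)}.
       (\<Sum>i. ennreal (unit_ball_vol s * (diameter (C i) / 2) powr s)))"

definition hausdorff_measure :: "real \<Rightarrow> 'a::euclidean_space measure" where
  "hausdorff_measure s = measure_of UNIV (sets borel) (hausdorff_outer s)"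

definition surface_measure :: "'a::euclidean_space set \<Rightarrow> 'a measure" where
  "surface_measure \<Omega> = restrict_space (hausdorff_measure (real DIM('a) - 1)) (frontier \<Omega>)"

text \<open>
  The trace operator is the continuous extension, from \<open>W\<^sup>1\<^sup>,\<^sup>p(\<Omega>)\<close> to
  \<open>L\<^sup>p(\<partial>\<Omega>)\<close>, of the restriction to the boundary of functions that are continuous up to
  the boundary. So \<open>g\<close> is the trace of \<open>u\<close> iff it is the \<open>L\<^sup>p\<close> limit of the
  boundary values of such functions converging to \<open>u\<close> in \<open>W\<^sup>1\<^sup>,\<^sup>p\<close>.
\<close>

definition has_trace :: "'a::euclidean_space set \<Rightarrow> real \<Rightarrow> ('a \<Rightarrow> real) \<Rightarrow> ('a \<Rightarrow> real) \<Rightarrow> bool" where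
  "has_trace \<Omega> p u g \<longleftrightarrow> u \<in> W1p \<Omega> p \<and> g \<in> borel_measurable (surface_measure \<Omega>) \<and>
     (\<exists>w. (\<forall>k. w k \<in> W1p \<Omega> p \<and> continuous_on (closure \<Omega>) (w k)) \<and>
        (\<lambda>k. \<integral>x. \<bar>w k x - u x\<bar> powr p \<partial>lebesgue_on \<Omega>) \<longlonglongrightarrow> 0 \<and>
        (\<lambda>k. \<integral>x. norm (wgrad \<Omega> (w k) x - wgrad \<Omega> u x) powr p \<partial>lebesgue_on \<Omega>) \<longlonglongrightarrow> 0 \<and>
        (\<lambda>k. \<integral>\<^sup>+x. ennreal (\<bar>w k x - g x\<bar> powr p) \<partial>surface_measure \<Omega>) \<longlonglongrightarrow> 0)"

definition W1p_bdry :: "'a::euclidean_space set \<Rightarrow> real \<Rightarrow> ('a \<Rightarrow> real) \<Rightarrow> ('a \<Rightarrow> real) set" where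
  "W1p_bdry \<Omega> p \<phi> = {u \<in> W1p \<Omega> p. \<exists>g. has_trace \<Omega> p \<phi> g \<and> has_trace \<Omega> p u g}"

section \<open>The variational problem and the distributional equation\<close>

text \<open>
  For kernels with the growth considered here, the integrand is integrable for every
  \<open>v\<close> in \<open>W\<^sup>1\<^sup>,\<^sup>p\<close>.
\<close>

definition energy ::
  "'a::euclidean_space set \<Rightarrow> ('a \<Rightarrow> real \<Rightarrow> 'a \<Rightarrow> real) \<Rightarrow> ('a \<Rightarrow> real) \<Rightarrow> real" where
  "energy \<Omega> F v = (\<integral>X. F X (v X) (wgrad \<Omega> v X) \<partial>lebesgue_on \<Omega>)"

definition is_minimizer ::
  "'a::euclidean_space set \<Rightarrow> real \<Rightarrow> ('a \<Rightarrow> real) \<Rightarrow> ('a \<Rightarrow> real \<Rightarrow> 'a \<Rightarrow> real) \<Rightarrow> ('a \<Rightarrow> real) \<Rightarrow> bool" where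
  "is_minimizer \<Omega> p \<phi> F u \<longleftrightarrow>
     u \<in> W1p_bdry \<Omega> p \<phi> \<and> (\<forall>v\<in>W1p_bdry \<Omega> p \<phi>. energy \<Omega> F u \<le> energy \<Omega> F v)"

definition strictly_convex :: "('a::euclidean_space \<Rightarrow> real) \<Rightarrow> bool" where
  "strictly_convex f \<longleftrightarrow> (\<forall>x y t. x \<noteq> y \<and> 0 < t \<and> t < 1 \<longrightarrow>
     f ((1 - t) *\<^sub>R x + t *\<^sub>R y) < (1 - t) * f x + t * f y)"

definition hoelder_on :: "real \<Rightarrow> 'a::euclidean_space set \<Rightarrow> ('a \<Rightarrow> real) \<Rightarrow> bool" where
  "hoelder_on \<beta> S Q \<longleftrightarrow> (\<exists>C. \<forall>x\<in>S. \<forall>y\<in>S. \<bar>Q x - Q y\<bar> \<le> C * dist x y powr \<beta>)"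

text \<open>\<open>div V = h\<close> in the sense of distributions on the open set \<open>U\<close>.\<close>

definition distributional_div ::
  "'a::euclidean_space set \<Rightarrow> ('a \<Rightarrow> 'a) \<Rightarrow> ('a \<Rightarrow> real) \<Rightarrow> bool" where
  "distributional_div U V h \<longleftrightarrow> locally_integrable U V \<and> locally_integrable U h \<and>
     (\<forall>\<psi>\<in>test_functions U.
        - (\<integral>X. V X \<bullet> grad \<psi> X \<partial>lebesgue_on U) = (\<integral>X. h X * \<psi> X \<partial>lebesgue_on U))"

end

theory Submission
  imports Defs
begin

text \<open>
  Let \<open>\<psi>\<close> be a test function on \<open>{u > 0}\<close>. On its compact support the continuous function
  \<open>u\<close> is bounded below by a positive constant, so for small \<open>t\<close> the competitor \<open>u + t \<psi>\<close> is
  positive exactly where \<open>u\<close> is. The discontinuous term \<open>Q \<chi>\<^bsub>{u > 0}\<^esub>\<close> of the energy therefore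
  does not change, and what remains depends on \<open>t\<close> through the convex functions \<open>G X\<close> and
  \<open>s \<mapsto> (s\<^sup>+)\<^sup>m\<close>. Dividing the energy difference by \<open>t > 0\<close> and letting \<open>t \<rightarrow> 0\<close> shows that the first
  variation \<open>\<integral> \<nabla>\<psi> \<bullet> \<A>(X, \<nabla>u) + m f u\<^bsup>m-1\<^esup> \<psi>\<close> is nonnegative; it is linear in \<open>\<psi>\<close>, so the same
  inequality for \<open>- \<psi>\<close> makes it zero, which is the equation.

  The limit may be taken under the integral because of convexity. For a convex \<open>\<Phi> \<ge> 0\<close> and
  \<open>0 < t \<le> 1\<close> the quotient \<open>(\<Phi> (\<xi> + t \<eta>) - \<Phi> \<xi>) / t\<close> is bounded by
  \<open>\<Phi> (\<xi> + \<eta>) + \<Phi> (\<xi> - \<eta>) + 2 \<Phi> \<xi>\<close> (\<open>convex_quotient_bound\<close>), so the growth condition on \<open>G\<close> alone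
  supplies an integrable majorant. This gives
  \<open>first_variation_convex_integrand\<close>, which is applied to both convex terms in
  \<open>energy_first_variation\<close>. With constant directions \<open>\<eta>\<close> it also shows that \<open>\<A>(X, \<nabla>u)\<close> is integrable.

  The competitor must be admissible, and its weak gradient must be \<open>\<nabla>u + t \<nabla>\<psi>\<close>. Since
  \<^const>\<open>wgrad\<close> picks an arbitrary weak gradient, the latter rests on uniqueness up to null sets,
  that is, on the fundamental lemma of the calculus of variations. It needs a supply of test
  functions: the product of \<open>exp (- 1 / s)\<close> over the distances \<open>s\<close> to the faces of a box is a smooth
  bump, whose \<open>j\<close>-th roots converge to the indicator of the box, and a function whose
  integral over all boxes vanishes is zero almost everywhere. That the gradient of a test function
  is its weak gradient (integration by parts) follows from the translation invariance of Lebesgue measure. The boundary values are not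
  affected, because a test function on \<open>\<Omega>\<close> vanishes on \<open>\<partial>\<Omega>\<close>.
\<close>

section \<open>Calculus of smooth functions\<close>

lemma grad_eqI:
  assumes "(f has_derivative (\<lambda>h. h \<bullet> D)) (at x)"
  shows "grad f x = D"
  unfolding grad_def gderiv_def
proof (rule the_equality[where P = "\<lambda>D. (f has_derivative (\<lambda>h. h \<bullet> D)) (at x)"])
  show "(f has_derivative (\<lambda>h. h \<bullet> D)) (at x)" by fact
  fix E assume "(f has_derivative (\<lambda>h. h \<bullet> E)) (at x)"
  from has_derivative_unique[OF this assms] have "\<forall>h. h \<bullet> E = h \<bullet> D" by metis
  then show "E = D" by (simp only: vector_eq_ldot)
qed

lemma has_derivative_grad:
  fixes f :: "'a::euclidean_space \<Rightarrow> real"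
  assumes "f differentiable (at x)"
  shows "(f has_derivative (\<lambda>h. h \<bullet> grad f x)) (at x)"
proof -
  from assms obtain f' where f': "(f has_derivative f') (at x)"
    by (auto simp: differentiable_def)
  interpret f': bounded_linear f' using f' by (rule has_derivative_bounded_linear)
  have "f' = (\<lambda>h. h \<bullet> (\<Sum>b\<in>Basis. f' b *\<^sub>R b))"
  proof
    fix h
    have "f' h = f' (\<Sum>b\<in>Basis. (h \<bullet> b) *\<^sub>R b)" by (simp add: euclidean_representation)
    also have "\<dots> = h \<bullet> (\<Sum>b\<in>Basis. f' b *\<^sub>R b)"
      by (simp add: f'.sum f'.scaleR inner_sum_right mult.commute)
    finally show "f' h = h \<bullet> (\<Sum>b\<in>Basis. f' b *\<^sub>R b)" .
  qed
  with f' have "(f has_derivative (\<lambda>h. h \<bullet> (\<Sum>b\<in>Basis. f' b *\<^sub>R b))) (at x)" by simp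
  with grad_eqI show ?thesis by fastforce
qed

lemma grad_add:
  assumes "f differentiable (at x)" "g differentiable (at x)"
  shows "grad (\<lambda>x. f x + g x) x = grad f x + grad g x"
  by (rule grad_eqI)
    (use has_derivative_add[OF has_derivative_grad[OF assms(1)] has_derivative_grad[OF assms(2)]]
      in \<open>simp add: inner_add_right\<close>)

lemma grad_mult:
  assumes "f differentiable (at x)" "g differentiable (at x)"
  shows "grad (\<lambda>x. f x * g x) x = f x *\<^sub>R grad g x + g x *\<^sub>R grad f x"
  by (rule grad_eqI)
    (use has_derivative_mult[OF has_derivative_grad[OF assms(1)] has_derivative_grad[OF assms(2)]]
      in \<open>simp add: inner_add_right mult.commute\<close>)

lemma grad_cmult:
  assumes "f differentiable (at x)"
  shows "grad (\<lambda>x. c * f x) x = c *\<^sub>R grad f x"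
  by (rule grad_eqI)
    (use has_derivative_mult_right[OF has_derivative_grad[OF assms], of c] in simp)

lemma grad_eq_0_outside_closure:
  assumes "x \<notin> closure {x. f x \<noteq> 0}"
  shows "grad f x = 0"
proof (rule grad_eqI)
  have "((\<lambda>x. 0) has_derivative (\<lambda>h. h \<bullet> 0)) (at x)" by simp
  then show "(f has_derivative (\<lambda>h. h \<bullet> 0)) (at x)"
  proof (rule has_derivative_transform_within_open)
    show "open (- closure {x. f x \<noteq> 0})" by auto
    show "x \<in> - closure {x. f x \<noteq> 0}" using assms by simp
    show "0 = f y" if "y \<in> - closure {x. f x \<noteq> 0}" for y
      using that closure_subset[of "{x. f x \<noteq> 0}"] by auto
  qed
qed

lemma C_k_imp_continuous: "C_k k f \<Longrightarrow> continuous_on UNIV f"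
  by (cases k) (auto intro!: differentiable_imp_continuous_on simp: differentiable_on_def)

lemma C_k_SucD: "C_k (Suc k) f \<Longrightarrow> C_k k f"
proof (induction k arbitrary: f)
  case 0
  show ?case using C_k_imp_continuous[OF 0] by simp
qed auto

lemma C_k_const: "C_k k (\<lambda>x. c)"
proof (induction k arbitrary: c)
  case (Suc k)
  have "grad (\<lambda>x. c) = (\<lambda>x. 0::'a)" by (rule ext, rule grad_eqI) simp
  with Suc show ?case by simp
qed simp

lemma C_k_add: "C_k k f \<Longrightarrow> C_k k g \<Longrightarrow> C_k k (\<lambda>x. f x + g x)"
proof (induction k arbitrary: f g)
  case (Suc k)
  then have "(\<lambda>x. grad (\<lambda>x. f x + g x) x \<bullet> b) = (\<lambda>x. grad f x \<bullet> b + grad g x \<bullet> b)" for b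
    by (simp add: grad_add inner_add_left)
  with Suc show ?case by auto
qed (auto intro: continuous_on_add)

lemma C_k_mult: "C_k k f \<Longrightarrow> C_k k g \<Longrightarrow> C_k k (\<lambda>x. f x * g x)"
proof (induction k arbitrary: f g)
  case (Suc k)
  then have "(\<lambda>x. grad (\<lambda>x. f x * g x) x \<bullet> b) = (\<lambda>x. f x * (grad g x \<bullet> b) + g x * (grad f x \<bullet> b))" for b
    by (simp add: grad_mult inner_add_left)
  with Suc.prems Suc.prems[THEN C_k_SucD] show ?case by (auto intro!: C_k_add Suc.IH)
qed (auto intro: continuous_on_mult)

lemma C_k_prod: "(\<And>i. i \<in> I \<Longrightarrow> C_k k (f i)) \<Longrightarrow> C_k k (\<lambda>x. \<Prod>i\<in>I. f i x)"
  by (induction I rule: infinite_finite_induct) (auto intro: C_k_const C_k_mult)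

lemma smooth_imp_differentiable: "smooth f \<Longrightarrow> f differentiable (at x)"
  unfolding smooth_def by (metis C_k.simps(2))

lemma smooth_imp_continuous: "smooth f \<Longrightarrow> continuous_on S f"
  unfolding smooth_def by (meson C_k_imp_continuous continuous_on_subset subset_UNIV)

lemma smooth_imp_continuous_grad:
  assumes "smooth f"
  shows "continuous_on S (grad f)"
proof -
  have "C_k (Suc 0) f" using assms unfolding smooth_def by blast
  then have "continuous_on UNIV (\<lambda>x. \<Sum>b\<in>Basis. (grad f x \<bullet> b) *\<^sub>R b)"
    by (intro continuous_on_sum continuous_on_scaleR continuous_on_const) simp
  then show ?thesis
    by (simp add: euclidean_representation) (meson continuous_on_subset subset_UNIV)
qed

lemma smooth_mult: "smooth f \<Longrightarrow> smooth g \<Longrightarrow> smooth (\<lambda>x. f x * g x)"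
  by (simp add: smooth_def C_k_mult)

lemma test_functionsD:
  assumes "\<psi> \<in> test_functions \<Omega>"
  shows "smooth \<psi>" "compact (closure {x. \<psi> x \<noteq> 0})" "closure {x. \<psi> x \<noteq> 0} \<subseteq> \<Omega>"
    "x \<notin> closure {x. \<psi> x \<noteq> 0} \<Longrightarrow> \<psi> x = 0" "x \<notin> closure {x. \<psi> x \<noteq> 0} \<Longrightarrow> grad \<psi> x = 0"
  using assms closure_subset[of "{x. \<psi> x \<noteq> 0}"] grad_eq_0_outside_closure[of x \<psi>]
  by (auto simp: test_functions_def)

lemma test_functions_mono: "U \<subseteq> \<Omega> \<Longrightarrow> test_functions U \<subseteq> test_functions \<Omega>"
  by (auto simp: test_functions_def)

lemma test_functions_mult:
  assumes "\<psi> \<in> test_functions \<Omega>" "smooth \<eta>"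
  shows "(\<lambda>x. \<eta> x * \<psi> x) \<in> test_functions \<Omega>"
proof -
  have "closure {x. \<eta> x * \<psi> x \<noteq> 0} \<subseteq> closure {x. \<psi> x \<noteq> 0}"
    by (rule closure_mono) auto
  moreover from this have "compact (closure {x. \<eta> x * \<psi> x \<noteq> 0})"
    using test_functionsD(2)[OF assms(1)]
    by (meson bounded_subset closed_closure compact_eq_bounded_closed)
  ultimately show ?thesis
    using assms by (auto simp: test_functions_def smooth_mult)
qed

lemma test_functions_cmult:
  "\<psi> \<in> test_functions \<Omega> \<Longrightarrow> (\<lambda>x. c * \<psi> x) \<in> test_functions \<Omega>"
  by (rule test_functions_mult) (auto simp: smooth_def C_k_const)

section \<open>Smooth approximations of boxes\<close>

text \<open>
  The functions \<open>q (1 / s) exp (- 1 / s)\<close>, extended by zero. They are introduced for all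
  polynomials \<open>q\<close> at once because this class is closed under differentiation, so that smoothness
  is a single induction; only \<open>q = 1\<close> is used afterwards.
\<close>

definition flat :: "real poly \<Rightarrow> real \<Rightarrow> real" where
  "flat q s = (if 0 < s then poly q (1 / s) * exp (- (1 / s)) else 0)"

lemma poly_times_exp_neg_tendsto_0: "((\<lambda>y::real. poly q y * exp (- y)) \<longlongrightarrow> 0) at_top"
proof -
  have "((\<lambda>y::real. \<Sum>i\<le>degree q. coeff q i * (y ^ i / exp y)) \<longlongrightarrow> (\<Sum>i\<le>degree q. coeff q i * 0)) at_top"
    by (intro tendsto_intros tendsto_power_div_exp_0)
  then show ?thesis
    by (simp add: poly_altdef exp_minus sum_distrib_right divide_inverse mult.assoc)
qed

text \<open>
  Away from \<open>0\<close> this is the chain rule. At \<open>0\<close> the right difference quotient is, in the variable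
  \<open>y = 1 / s\<close>, a polynomial times \<open>exp (- y)\<close>, which vanishes as \<open>y \<rightarrow> \<infinity>\<close>.
\<close>

lemma flat_has_derivative:
  "(flat q has_real_derivative flat ([:0, 0, 1:] * (q - pderiv q)) s) (at s)"
proof -
  consider "0 < s" | "s < 0" | "s = 0" by linarith
  then show ?thesis
  proof cases
    case 1
    have "((\<lambda>s. poly q (1 / s) * exp (- (1 / s))) has_real_derivative
      flat ([:0, 0, 1:] * (q - pderiv q)) s) (at s)"
      using 1 by (auto intro!: derivative_eq_intros simp: flat_def field_simps power2_eq_square)
    then show ?thesis
      by (rule has_field_derivative_transform_within_open[of _ _ _ "{0<..}"])
        (use 1 in \<open>auto simp: flat_def\<close>)
  next
    case 2
    have "((\<lambda>s. 0) has_real_derivative flat ([:0, 0, 1:] * (q - pderiv q)) s) (at s)"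
      using 2 by (simp add: flat_def)
    then show ?thesis
      by (rule has_field_derivative_transform_within_open[of _ _ _ "{..<0}"])
        (use 2 in \<open>auto simp: flat_def\<close>)
  next
    case 3
    have "((\<lambda>h. (flat q h - flat q 0) / (h - 0)) \<longlongrightarrow> 0) (at 0)"
    proof (rule filterlim_split_at_real)
      have "((\<lambda>h::real. poly (pCons 0 q) (inverse h) * exp (- inverse h)) \<longlongrightarrow> 0) (at_right 0)"
        by (rule filterlim_compose[OF poly_times_exp_neg_tendsto_0 filterlim_inverse_at_top_right])
      then show "((\<lambda>h. (flat q h - flat q 0) / (h - 0)) \<longlongrightarrow> 0) (at_right 0)"
        by (rule Lim_transform_eventually)
          (auto simp: eventually_at_filter flat_def field_simps)
      show "((\<lambda>h. (flat q h - flat q 0) / (h - 0)) \<longlongrightarrow> 0) (at_left 0)"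
        by (rule tendsto_eventually) (auto simp: eventually_at_filter flat_def)
    qed
    then show ?thesis
      unfolding 3 has_field_derivative_iff by (simp add: flat_def)
  qed
qed

lemma C_k_flat: "C_k k (\<lambda>x. flat q (x \<bullet> v + c))"
proof (induction k arbitrary: q)
  case 0
  have "continuous_on UNIV (flat q)"
    using flat_has_derivative by (auto intro!: continuous_at_imp_continuous_on DERIV_isCont)
  then show ?case
    by (auto intro!: continuous_on_compose2[of UNIV "flat q"] continuous_intros)
next
  case (Suc k)
  let ?r = "[:0, 0, 1:] * (q - pderiv q)"
  have D: "((\<lambda>x. flat q (x \<bullet> v + c)) has_derivative (\<lambda>h. h \<bullet> (flat ?r (x \<bullet> v + c) *\<^sub>R v))) (at x)" for x
    by (rule has_derivative_compose[where g = "flat q",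
        OF _ flat_has_derivative[unfolded has_field_derivative_def], THEN has_derivative_eq_rhs])
      (auto intro!: derivative_eq_intros)
  then have "grad (\<lambda>x. flat q (x \<bullet> v + c)) x = flat ?r (x \<bullet> v + c) *\<^sub>R v" for x
    by (rule grad_eqI)
  moreover have "C_k k (\<lambda>x. flat ?r (x \<bullet> v + c) * (v \<bullet> b))" for b
    by (intro C_k_mult C_k_const Suc)
  ultimately show ?case using D by (auto simp: differentiable_def)
qed

text \<open>
  Since \<open>flat 1 (j s) = (flat 1 s)\<^bsup>1/j\<^esup>\<close>, these are the roots of one fixed bump function that is
  positive exactly on the open box, and so they increase to its indicator.
\<close>

definition box_bump :: "'a::euclidean_space \<Rightarrow> 'a \<Rightarrow> nat \<Rightarrow> 'a \<Rightarrow> real" where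
  "box_bump a b j x = (\<Prod>i\<in>Basis. flat 1 (real (Suc j) * (x \<bullet> i - a \<bullet> i)) *
     flat 1 (real (Suc j) * (b \<bullet> i - x \<bullet> i)))"

lemma flat_1_bounds: "0 \<le> flat 1 s" "flat 1 s \<le> 1"
  by (auto simp: flat_def)

lemma box_bump_bounds: "0 \<le> box_bump a b j x" "box_bump a b j x \<le> 1"
  unfolding box_bump_def
  by (auto intro!: prod_nonneg prod_le_1 mult_le_one simp: flat_1_bounds)

lemma box_bump_eq_0:
  assumes "x \<notin> box a b"
  shows "box_bump a b j x = 0"
proof -
  from assms obtain i where "i \<in> Basis" "x \<bullet> i \<le> a \<bullet> i \<or> b \<bullet> i \<le> x \<bullet> i"
    by (auto simp: mem_box not_less)
  then show ?thesis
    by (auto simp: box_bump_def flat_def mult_le_0_iff not_less zero_less_mult_iff intro!: bexI[of _ i])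
qed

lemma box_bump_tendsto: "(\<lambda>j. box_bump a b j x) \<longlonglongrightarrow> indicator (box a b) x"
proof (cases "x \<in> box a b")
  case True
  have *: "(\<lambda>j. flat 1 (real (Suc j) * s)) \<longlonglongrightarrow> 1" if "s > 0" for s
  proof -
    have "(\<lambda>j. exp (- (inverse (real (Suc j)) * (1 / s)))) \<longlonglongrightarrow> exp (- (0 * (1 / s)))"
      by (intro tendsto_intros LIMSEQ_inverse_real_of_nat)
    moreover have "exp (- (inverse (real (Suc j)) * (1 / s))) = flat 1 (real (Suc j) * s)" for j
      using that by (simp add: flat_def divide_inverse)
    ultimately show ?thesis by simp
  qed
  have "(\<lambda>j. box_bump a b j x) \<longlonglongrightarrow> (\<Prod>i\<in>(Basis::'a set). 1 * 1)"
    unfolding box_bump_def using True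
    by (intro tendsto_prod tendsto_mult *) (auto simp: mem_box)
  with True show ?thesis by simp
qed (simp add: box_bump_eq_0)

lemma smooth_box_bump: "smooth (box_bump a b j)"
proof -
  have "C_k k (\<lambda>x. flat 1 (real (Suc j) * (x \<bullet> i - a \<bullet> i)))" for k i
    using C_k_flat[of k 1 "real (Suc j) *\<^sub>R i" "- real (Suc j) * (a \<bullet> i)"]
    by (simp add: algebra_simps)
  moreover have "C_k k (\<lambda>x. flat 1 (real (Suc j) * (b \<bullet> i - x \<bullet> i)))" for k i
    using C_k_flat[of k 1 "- real (Suc j) *\<^sub>R i" "real (Suc j) * (b \<bullet> i)"]
    by (simp add: algebra_simps)
  ultimately show ?thesis
    unfolding smooth_def box_bump_def[abs_def] by (intro allI C_k_prod C_k_mult)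
qed

lemma box_bump_in_test_functions:
  assumes "cbox a b \<subseteq> \<Omega>"
  shows "box_bump a b j \<in> test_functions \<Omega>"
proof -
  have "{x. box_bump a b j x \<noteq> 0} \<subseteq> cbox a b"
    using box_bump_eq_0 box_subset_cbox by blast
  then have *: "closure {x. box_bump a b j x \<noteq> 0} \<subseteq> cbox a b"
    by (rule closure_minimal) (rule closed_cbox)
  then have "compact (closure {x. box_bump a b j x \<noteq> 0})"
    by (meson bounded_cbox bounded_subset closed_closure compact_eq_bounded_closed)
  with * assms show ?thesis
    by (auto simp: test_functions_def smooth_box_bump)
qed

section \<open>The fundamental lemma of the calculus of variations\<close>

text \<open>
  This makes every integral in the definition of a weak gradient converge. The product is an
  arbitrary bilinear map because scalars multiply vectors on either side there.
\<close>

lemma integrable_compact_support_times_locally_integrable: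
  fixes c :: "'a::euclidean_space \<Rightarrow> 'b::euclidean_space"
    and h :: "'a \<Rightarrow> 'c::euclidean_space" and B :: "'b \<Rightarrow> 'c \<Rightarrow> 'd::euclidean_space"
  assumes B: "bounded_bilinear B" and \<Omega>: "open \<Omega>" and h: "locally_integrable \<Omega> h"
    and K: "compact K" "K \<subseteq> \<Omega>"
    and c: "continuous_on K c" "\<And>x. x \<notin> K \<Longrightarrow> c x = 0"
  shows "integrable (lebesgue_on \<Omega>) (\<lambda>x. B (c x) (h x))"
proof -
  interpret B: bounded_bilinear B by (rule B)
  have sets: "K \<in> sets lebesgue" "\<Omega> \<in> sets lebesgue"
    using K(1) \<Omega> by (simp_all add: lmeasurable_compact fmeasurableD)
  have "(\<lambda>x. B (c x) (h x)) absolutely_integrable_on K"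
  proof (rule absolutely_integrable_bounded_measurable_product[where h = B and f = c and g = h])
    show "bilinear B" using B by (simp add: bilinear_conv_bounded_bilinear)
    show "c \<in> borel_measurable (lebesgue_on K)"
      by (rule continuous_imp_measurable_on_sets_lebesgue[OF c(1) sets(1)])
    show "bounded (c ` K)"
      by (intro compact_imp_bounded compact_continuous_image c(1) K(1))
    show "h absolutely_integrable_on K" using h K by (simp add: locally_integrable_def)
  qed (rule sets)
  then have "integrable lebesgue (\<lambda>x. indicator K x *\<^sub>R B (c x) (h x))"
    by (simp add: set_integrable_def)
  moreover have "indicator K x *\<^sub>R B (c x) (h x) = indicator \<Omega> x *\<^sub>R B (c x) (h x)" for x
    using c(2)[of x] K by (cases "x \<in> K") (auto simp: indicator_def B.zero_left)
  ultimately show ?thesis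
    using sets by (simp add: integrable_restrict_space)
qed

lemma integral_lebesgue_on_eq_lebesgue:
  fixes f :: "'a::euclidean_space \<Rightarrow> 'b::euclidean_space"
  assumes "open \<Omega>" "\<And>x. x \<notin> \<Omega> \<Longrightarrow> f x = 0"
  shows "integrable (lebesgue_on \<Omega>) f \<longleftrightarrow> integrable lebesgue f"
    "(\<integral>x. f x \<partial>lebesgue_on \<Omega>) = (\<integral>x. f x \<partial>lebesgue)"
proof -
  have "(\<lambda>x. indicator \<Omega> x *\<^sub>R f x) = f"
    using assms(2) by (auto simp: indicator_def fun_eq_iff)
  then show "integrable (lebesgue_on \<Omega>) f \<longleftrightarrow> integrable lebesgue f"
    "(\<integral>x. f x \<partial>lebesgue_on \<Omega>) = (\<integral>x. f x \<partial>lebesgue)"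
    using assms(1) by (simp_all add: integrable_restrict_space integral_restrict_space)
qed

lemma sigma_finite_completion:
  assumes "sigma_finite_measure M"
  shows "sigma_finite_measure (completion M)"
proof -
  interpret sigma_finite_measure M by fact
  obtain A where "countable A" "A \<subseteq> sets M" "\<Union>A = space M" "\<forall>a\<in>A. emeasure M a \<noteq> \<infinity>"
    using sigma_finite_countable by metis
  then show ?thesis
    by (intro sigma_finite_measure.intro exI[of _ A]) auto
qed

text \<open>
  Boxes are closed under intersection and generate the Borel sets, so by Dynkin's argument all
  integrals over Borel sets vanish. The last hypothesis serves the complements: the whole
  space is not a box. A Lebesgue set differs from a Borel set by a null set.
\<close>

lemma AE_eq_0_if_integral_boxes_0:
  fixes H :: "'a::euclidean_space \<Rightarrow> 'b::euclidean_space"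
  assumes H: "integrable lebesgue H"
    and boxes: "\<And>a b. (\<integral>x. indicator (box a b) x *\<^sub>R H x \<partial>lebesgue) = 0"
    and total: "(\<integral>x. H x \<partial>lebesgue) = 0"
  shows "AE x in lebesgue. H x = 0"
proof (rule sigma_finite_measure.density_zero[OF sigma_finite_completion[OF sigma_finite_lborel] H])
  have borel: "set_lebesgue_integral lebesgue A H = 0"
    if "A \<in> sigma_sets UNIV (range (\<lambda>(a, b). box a b :: 'a set))" for A
  proof -
    have stable: "Int_stable (range (\<lambda>(a, b). box a b :: 'a set))"
      by (auto simp: Int_stable_def box_Int_box)
    have closed: "range (\<lambda>(a, b). box a b :: 'a set) \<subseteq> Pow UNIV"
      by simp
    show ?thesis
      using stable closed that
    proof (induction rule: sigma_sets_induct_disjoint)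
      case (basic A)
      then show ?case using boxes by (auto simp: set_lebesgue_integral_def)
    next
      case empty
      show ?case by (simp add: set_lebesgue_integral_def)
    next
      case (compl A)
      then have "A \<in> sets borel" by (simp add: borel_eq_box)
      then have "integrable lebesgue (\<lambda>x. indicator A x *\<^sub>R H x)"
        by (intro integrable_mult_indicator H) auto
      moreover have "indicator (UNIV - A) x *\<^sub>R H x = H x - indicator A x *\<^sub>R H x" for x
        by (auto simp: indicator_def)
      ultimately show ?case
        using compl H total by (simp add: set_lebesgue_integral_def)
    next
      case (union A)
      then have "A i \<in> sets borel" for i by (auto simp: borel_eq_box)
      then have A: "A i \<in> sets lebesgue" for i by auto
      have "set_lebesgue_integral lebesgue (\<Union>i. A i) H = (\<Sum>i. set_lebesgue_integral lebesgue (A i) H)"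
        using A union.hyps(1) unfolding set_integrable_def disjoint_family_on_def
        by (intro lebesgue_integral_countable_add)
          (auto simp: set_integrable_def intro!: integrable_mult_indicator H)
      with union.IH show ?case by simp
    qed
  qed
  fix A :: "'a set" assume "A \<in> sets lebesgue"
  then obtain S N N' where A: "A = S \<union> N" "N \<subseteq> N'" "N' \<in> null_sets lborel" "S \<in> sets lborel"
    by (rule sets_completionE)
  have "AE x in lebesgue. x \<notin> N'"
    using A(3) by (intro AE_not_in null_sets_completionI)
  then have "set_lebesgue_integral lebesgue A H = set_lebesgue_integral lebesgue S H"
    unfolding set_lebesgue_integral_def
    using A \<open>A \<in> sets lebesgue\<close> H
    by (intro integral_cong_AE borel_measurable_scaleR borel_measurable_indicator)
     (auto simp: indicator_def)
  also have "\<dots> = 0" using A(4) borel by (simp add: borel_eq_box)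
  finally show "set_lebesgue_integral lebesgue A H = 0" .
qed

text \<open>
  Testing with the bumps of a box and passing to the limit shows that \<open>h\<close> has integral zero over each
  box with closure in \<open>\<Omega>\<close>. Hence \<open>h\<close> vanishes almost everywhere on each such box, and
  countably many of them cover \<open>\<Omega>\<close>.
\<close>

lemma fundamental_lemma_calculus_of_variations:
  fixes h :: "'a::euclidean_space \<Rightarrow> 'b::euclidean_space"
  assumes \<Omega>: "open \<Omega>" and h: "locally_integrable \<Omega> h"
    and 0: "\<And>\<psi>. \<psi> \<in> test_functions \<Omega> \<Longrightarrow> (\<integral>x. \<psi> x *\<^sub>R h x \<partial>lebesgue_on \<Omega>) = 0"
  shows "AE x in lebesgue_on \<Omega>. h x = 0"
proof -
  have int: "integrable (lebesgue_on \<Omega>) (\<lambda>x. indicat_real (cbox a b) x *\<^sub>R h x)" if "cbox a b \<subseteq> \<Omega>"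
      for a b
    using that
    by (intro integrable_compact_support_times_locally_integrable[OF bounded_bilinear_scaleR \<Omega> h, of "cbox a b"])
      (auto simp: indicator_def)
  have box: "(\<integral>x. indicator (box a b) x *\<^sub>R h x \<partial>lebesgue) = 0" if "cbox a b \<subseteq> \<Omega>" for a b
  proof -
    have "(\<lambda>j. \<integral>x. box_bump a b j x *\<^sub>R h x \<partial>lebesgue_on \<Omega>)
      \<longlonglongrightarrow> (\<integral>x. indicat_real (box a b) x *\<^sub>R h x \<partial>lebesgue_on \<Omega>)"
    proof (rule integral_dominated_convergence)
      show "integrable (lebesgue_on \<Omega>) (\<lambda>x. norm (indicat_real (cbox a b) x *\<^sub>R h x))"
        by (rule integrable_norm[OF int[OF that]])
      show "AE x in lebesgue_on \<Omega>. (\<lambda>j. box_bump a b j x *\<^sub>R h x) \<longlonglongrightarrow> indicat_real (box a b) x *\<^sub>R h x"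
        by (intro AE_I2 tendsto_intros box_bump_tendsto)
      show "AE x in lebesgue_on \<Omega>. norm (box_bump a b j x *\<^sub>R h x)
          \<le> norm (indicat_real (cbox a b) x *\<^sub>R h x)" for j
      proof (rule AE_I2)
        fix x
        have "box_bump a b j x \<le> indicator (cbox a b) x"
          using box_bump_eq_0[of x a b j] box_bump_bounds[of a b j x] box_subset_cbox[of a b]
          by (cases "x \<in> box a b") auto
        then show "norm (box_bump a b j x *\<^sub>R h x) \<le> norm (indicat_real (cbox a b) x *\<^sub>R h x)"
          using box_bump_bounds[of a b j x] by (simp add: mult_right_mono)
      qed
      show meas: "(\<lambda>x. box_bump a b j x *\<^sub>R h x) \<in> borel_measurable (lebesgue_on \<Omega>)" for j
        using test_functionsD[OF box_bump_in_test_functions[OF that, of j]]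
        by (intro borel_measurable_integrable integrable_compact_support_times_locally_integrable[
              OF bounded_bilinear_scaleR \<Omega> h] smooth_imp_continuous)
      show "(\<lambda>x. indicat_real (box a b) x *\<^sub>R h x) \<in> borel_measurable (lebesgue_on \<Omega>)"
        by (rule borel_measurable_LIMSEQ_metric[where f = "\<lambda>j x. box_bump a b j x *\<^sub>R h x", OF meas])
          (intro tendsto_intros box_bump_tendsto)
    qed
    then have "(\<integral>x. indicat_real (box a b) x *\<^sub>R h x \<partial>lebesgue_on \<Omega>) = 0"
      using 0[OF box_bump_in_test_functions[OF that]] by (simp add: LIMSEQ_const_iff)
    moreover have "x \<in> \<Omega>" if "x \<in> box a b" for x
      using that \<open>cbox a b \<subseteq> \<Omega>\<close> box_subset_cbox[of a b] by blast
    ultimately show ?thesis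
      using \<Omega> by (subst (asm) integral_lebesgue_on_eq_lebesgue(2)) (auto simp: indicator_def)
  qed
  have AE_cbox: "AE x in lebesgue. x \<in> cbox c d \<longrightarrow> h x = 0" if cd: "cbox c d \<subseteq> \<Omega>" for c d
  proof -
    have interior: "AE x in lebesgue. x \<notin> cbox c d - box c d"
      using negligible_frontier_interval by (intro AE_not_in) (simp add: negligible_iff_null_sets)
    have "AE x in lebesgue. indicat_real (box c d) x *\<^sub>R h x = 0"
    proof (rule AE_eq_0_if_integral_boxes_0)
      have "integrable lebesgue (\<lambda>x. indicat_real (cbox c d) x *\<^sub>R h x)"
        using int[OF cd] cd \<Omega>
        by (subst (asm) integral_lebesgue_on_eq_lebesgue(1)) (auto simp: indicator_def)
      then have "integrable lebesgue (\<lambda>x. indicat_real (box c d) x *\<^sub>R indicat_real (cbox c d) x *\<^sub>R h x)"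
        by (rule integrable_mult_indicator[rotated]) simp
      moreover have "indicat_real (box c d) x *\<^sub>R indicat_real (cbox c d) x *\<^sub>R h x
          = indicat_real (box c d) x *\<^sub>R h x" for x
        using box_subset_cbox[of c d] by (auto simp: indicator_def)
      ultimately show "integrable lebesgue (\<lambda>x. indicat_real (box c d) x *\<^sub>R h x)"
        by (simp only:)
      show "(\<integral>x. indicat_real (box c d) x *\<^sub>R h x \<partial>lebesgue) = 0"
        by (rule box[OF cd])
      fix a b :: 'a
      \<comment> \<open>The intersection with \<open>box c d\<close> is again a box, and its closure stays inside \<open>\<Omega>\<close>.\<close>
      let ?a = "\<Sum>i\<in>Basis. max (a\<bullet>i) (c\<bullet>i) *\<^sub>R i" and ?b = "\<Sum>i\<in>Basis. min (b\<bullet>i) (d\<bullet>i) *\<^sub>R i"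
      have "cbox ?a ?b \<subseteq> cbox c d" by (auto simp: mem_box)
      moreover have "indicat_real (box a b) x *\<^sub>R indicat_real (box c d) x *\<^sub>R h x
        = indicat_real (box ?a ?b) x *\<^sub>R h x" for x
        unfolding box_Int_box[symmetric] by (simp add: indicator_inter_arith)
      moreover have "cbox ?a ?b \<subseteq> \<Omega>" using calculation(1) cd by (rule subset_trans)
      ultimately show "(\<integral>x. indicat_real (box a b) x *\<^sub>R indicat_real (box c d) x *\<^sub>R h x \<partial>lebesgue) = 0"
        by (simp only: box)
    qed
    with interior show ?thesis by eventually_elim (auto simp: indicator_def split: if_splits)
  qed
  obtain \<D> where \<D>: "countable \<D>" "\<D> \<subseteq> Pow \<Omega>" "\<And>X. X \<in> \<D> \<Longrightarrow> \<exists>a b. X = cbox a b" "\<Union>\<D> = \<Omega>"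
    using open_countable_Union_open_cbox[OF \<Omega>] by metis
  have "AE x in lebesgue. \<forall>X\<in>\<D>. x \<in> X \<longrightarrow> h x = 0"
    unfolding AE_ball_countable[OF \<D>(1)]
  proof
    fix X assume "X \<in> \<D>"
    then obtain a b where "X = cbox a b" "cbox a b \<subseteq> \<Omega>" using \<D>(2,3) by blast
    then show "AE x in lebesgue. x \<in> X \<longrightarrow> h x = 0" using AE_cbox by simp
  qed
  then have "AE x in lebesgue. x \<in> \<Omega> \<longrightarrow> h x = 0"
    using \<D>(4) by (auto elim: eventually_mono)
  then show ?thesis using \<Omega> by (simp add: AE_restrict_space_iff)
qed

section \<open>Weak gradients\<close>

lemma directional_quotient_tendsto:
  fixes f :: "'a::real_inner \<Rightarrow> real"
  assumes "(f has_derivative (\<lambda>h. h \<bullet> D)) (at x)"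
  shows "(\<lambda>n. (f (x + inverse (real (Suc n)) *\<^sub>R v) - f x) * real (Suc n)) \<longlonglongrightarrow> v \<bullet> D"
proof -
  have "((\<lambda>t. f (x + t *\<^sub>R v)) has_derivative (\<lambda>t. (t *\<^sub>R v) \<bullet> D)) (at 0)"
  proof (rule has_derivative_compose[where g = f])
    show "((\<lambda>t. x + t *\<^sub>R v) has_derivative (\<lambda>t. t *\<^sub>R v)) (at 0)"
      by (auto intro!: derivative_eq_intros)
    show "(f has_derivative (\<lambda>h. h \<bullet> D)) (at (x + 0 *\<^sub>R v))"
      using assms by simp
  qed
  then have "((\<lambda>t. f (x + t *\<^sub>R v)) has_real_derivative v \<bullet> D) (at 0)"
    by (simp add: has_field_derivative_def mult.commute[of _ "v \<bullet> D"])
  then have "((\<lambda>t. (f (x + t *\<^sub>R v) - f x) / t) \<longlongrightarrow> v \<bullet> D) (at 0)"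
    by (simp add: has_field_derivative_iff)
  moreover have "filterlim (\<lambda>n. inverse (real (Suc n))) (at 0) sequentially"
    using LIMSEQ_inverse_real_of_nat by (auto simp: filterlim_at)
  ultimately have "(\<lambda>n. (f (x + inverse (real (Suc n)) *\<^sub>R v) - f x) / inverse (real (Suc n))) \<longlonglongrightarrow> v \<bullet> D"
    by (rule filterlim_compose)
  then show ?thesis by (simp add: divide_inverse del: of_nat_Suc)
qed

lemma test_function_Lipschitz:
  fixes \<psi> :: "'a::euclidean_space \<Rightarrow> real"
  assumes "\<psi> \<in> test_functions UNIV"
  obtains L where "0 \<le> L" "\<And>x y. \<bar>\<psi> x - \<psi> y\<bar> \<le> L * norm (x - y)"
proof -
  note \<psi> = test_functionsD[OF assms]
  let ?K = "closure {x. \<psi> x \<noteq> 0}"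
  have "bounded (grad \<psi> ` ?K)"
    by (intro compact_imp_bounded compact_continuous_image smooth_imp_continuous_grad \<psi>(1,2))
  then obtain L where L: "0 < L" "\<And>x. x \<in> ?K \<Longrightarrow> norm (grad \<psi> x) \<le> L"
    by (auto simp: bounded_pos)
  have bound: "norm (grad \<psi> x) \<le> L" for x
    using L \<psi>(5)[of x] by (cases "x \<in> ?K") auto
  have "\<bar>\<psi> x - \<psi> y\<bar> \<le> L * norm (x - y)" for x y
  proof -
    have "norm (\<psi> x - \<psi> y) \<le> L * norm (x - y)"
    proof (rule differentiable_bound[OF convex_UNIV])
      fix x :: 'a
      show "(\<psi> has_derivative (\<lambda>h. h \<bullet> grad \<psi> x)) (at x)"
        by (intro has_derivative_grad smooth_imp_differentiable \<psi>(1))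
      show "onorm (\<lambda>h. h \<bullet> grad \<psi> x) \<le> L"
      proof (rule onorm_le)
        fix h
        have "norm (h \<bullet> grad \<psi> x) \<le> norm h * norm (grad \<psi> x)"
          by (simp add: Cauchy_Schwarz_ineq2)
        also have "\<dots> \<le> L * norm h"
          using mult_left_mono[OF bound norm_ge_zero, of h x] by (simp add: mult.commute)
        finally show "norm (h \<bullet> grad \<psi> x) \<le> L * norm h" .
      qed
    qed auto
    then show ?thesis by simp
  qed
  with L(1) show ?thesis by (intro that[of L]) auto
qed

lemma scaleR_indicator_cancel:
  fixes f :: "'a \<Rightarrow> 'b::real_vector"
  assumes "\<And>x. x \<notin> K \<Longrightarrow> f x = 0"
  shows "(\<lambda>x. indicator K x *\<^sub>R f x) = f"
  using assms by (auto simp: fun_eq_iff indicator_def)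

text \<open>
  By translation invariance the difference quotients in a direction \<open>e\<close> have integral zero. The
  Lipschitz bound dominates them by a constant on a ball that contains the support together with
  all its translates by vectors of length at most \<open>1\<close>, so their limit \<open>e \<bullet> \<nabla>\<psi>\<close> has integral zero too.
\<close>

lemma integral_grad_test_function:
  fixes \<psi> :: "'a::euclidean_space \<Rightarrow> real"
  assumes "\<psi> \<in> test_functions UNIV"
  shows "(\<integral>x. grad \<psi> x \<partial>lebesgue) = 0"
proof (rule euclidean_eqI)
  note \<psi> = test_functionsD[OF assms]
  let ?K = "closure {x. \<psi> x \<noteq> 0}"
  obtain L where L: "0 \<le> L" "\<And>x y. \<bar>\<psi> x - \<psi> y\<bar> \<le> L * norm (x - y)"
    using test_function_Lipschitz[OF assms] by metis
  obtain R where R: "\<And>x. x \<in> ?K \<Longrightarrow> norm x \<le> R"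
    using compact_imp_bounded[OF \<psi>(2)] by (auto simp: bounded_iff)
  have cont: "continuous_on UNIV \<psi>" by (rule smooth_imp_continuous[OF \<psi>(1)])
  have cont_grad: "continuous_on UNIV (grad \<psi>)" by (rule smooth_imp_continuous_grad[OF \<psi>(1)])
  have restrict: "(\<lambda>x. indicator ?K x *\<^sub>R \<psi> x) = \<psi>" "(\<lambda>x. indicator ?K x *\<^sub>R grad \<psi> x) = grad \<psi>"
    by (rule scaleR_indicator_cancel, rule \<psi>, assumption)+
  have int: "integrable lborel \<psi>" "integrable lborel (grad \<psi>)"
    using borel_integrable_compact[OF \<psi>(2) continuous_on_subset[OF cont subset_UNIV]]
      borel_integrable_compact[OF \<psi>(2) continuous_on_subset[OF cont_grad subset_UNIV]]
    unfolding restrict by this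
  fix e :: 'a assume e: "e \<in> Basis"
  have shift: "integrable lborel (\<lambda>x. \<psi> (x + v))" "(\<integral>x. \<psi> (x + v) \<partial>lborel) = (\<integral>x. \<psi> x \<partial>lborel)" for v
  proof -
    have [measurable]: "\<psi> \<in> borel_measurable borel"
      using cont by (rule borel_measurable_continuous_onI)
    have "integrable (distr lborel borel ((+) v)) \<psi>"
      using int(1) by (simp add: lborel_distr_plus)
    then show "integrable lborel (\<lambda>x. \<psi> (x + v))"
      by (subst (asm) integrable_distr_eq) (auto simp: add.commute)
    have "(\<integral>x. \<psi> x \<partial>distr lborel borel ((+) v)) = (\<integral>x. \<psi> (v + x) \<partial>lborel)"
      by (rule integral_distr) auto
    then show "(\<integral>x. \<psi> (x + v) \<partial>lborel) = (\<integral>x. \<psi> x \<partial>lborel)"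
      by (simp add: lborel_distr_plus add.commute)
  qed
  let ?q = "\<lambda>n x. (\<psi> (x + inverse (real (Suc n)) *\<^sub>R e) - \<psi> x) * real (Suc n)"
  have "(\<lambda>n. \<integral>x. ?q n x \<partial>lborel) \<longlonglongrightarrow> (\<integral>x. e \<bullet> grad \<psi> x \<partial>lborel)"
  proof (rule integral_dominated_convergence)
    show "integrable lborel (\<lambda>x. indicator (cball 0 (R + 1)) x *\<^sub>R L)"
      by (rule borel_integrable_compact) auto
    show "AE x in lborel. (\<lambda>n. ?q n x) \<longlonglongrightarrow> e \<bullet> grad \<psi> x"
      by (intro AE_I2 directional_quotient_tendsto has_derivative_grad smooth_imp_differentiable \<psi>(1))
    show "AE x in lborel. norm (?q n x) \<le> indicator (cball 0 (R + 1)) x *\<^sub>R L" for n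
    proof (rule AE_I2)
      fix x :: 'a
      let ?v = "inverse (real (Suc n)) *\<^sub>R e"
      have v: "norm ?v = inverse (real (Suc n))" using e by simp
      show "norm (?q n x) \<le> indicator (cball 0 (R + 1)) x *\<^sub>R L"
      proof (cases "x \<in> cball 0 (R + 1)")
        case True
        have "norm (?q n x) \<le> (L * inverse (real (Suc n))) * real (Suc n)"
          using L(2)[of "x + ?v" x] v by (simp add: abs_mult mult_right_mono del: of_nat_Suc)
        also have "\<dots> = L" by (simp add: mult.assoc del: of_nat_Suc)
        finally show ?thesis using True by simp
      next
        case False
        have "norm x \<le> norm (x + ?v) + norm ?v" by (metis add_diff_cancel norm_triangle_ineq4)
        moreover have "norm ?v \<le> 1" unfolding v by (simp add: inverse_le_1_iff)
        ultimately have "\<not> norm x \<le> R" "\<not> norm (x + ?v) \<le> R" using False by auto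
        then have "\<psi> x = 0" "\<psi> (x + ?v) = 0" by (blast intro: \<psi>(4) dest: R)+
        then show ?thesis using False by simp
      qed
    qed
    show "?q n \<in> borel_measurable lborel" for n
      using shift(1) int(1) by (intro borel_measurable_integrable) (auto intro!: integrable_mult_left)
    show "(\<lambda>x. e \<bullet> grad \<psi> x) \<in> borel_measurable lborel"
      using int(2) by (intro borel_measurable_integrable) (auto intro!: integrable_inner_right)
  qed
  moreover have "(\<integral>x. ?q n x \<partial>lborel) = 0" for n
    using shift int(1) by simp
  ultimately have "(\<integral>x. e \<bullet> grad \<psi> x \<partial>lborel) = 0" by (simp add: LIMSEQ_const_iff)
  moreover have "(\<integral>x. grad \<psi> x \<partial>lebesgue) = (\<integral>x. grad \<psi> x \<partial>lborel)"
    using int(2) by (intro integral_completion) auto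
  ultimately show "(\<integral>x. grad \<psi> x \<partial>lebesgue) \<bullet> e = 0 \<bullet> e"
    using int(2) by (simp add: integral_inner_right inner_commute)
qed

lemma locally_integrable_add:
  "locally_integrable \<Omega> h \<Longrightarrow> locally_integrable \<Omega> k \<Longrightarrow> locally_integrable \<Omega> (\<lambda>x. h x + k x)"
  by (auto simp: locally_integrable_def intro: set_integral_add)

lemma locally_integrable_diff:
  "locally_integrable \<Omega> h \<Longrightarrow> locally_integrable \<Omega> k \<Longrightarrow> locally_integrable \<Omega> (\<lambda>x. h x - k x)"
  by (auto simp: locally_integrable_def intro: set_integral_diff)

lemma continuous_imp_locally_integrable:
  fixes h :: "'a::euclidean_space \<Rightarrow> 'b::euclidean_space"
  assumes "continuous_on \<Omega> h"
  shows "locally_integrable \<Omega> h"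
  unfolding locally_integrable_def set_integrable_def
proof (intro allI impI)
  fix K assume "compact K \<and> K \<subseteq> \<Omega>"
  then have "integrable lborel (\<lambda>x. indicator K x *\<^sub>R h x)"
    using assms by (intro borel_integrable_compact) (auto intro: continuous_on_subset)
  then show "integrable lebesgue (\<lambda>x. indicat_real K x *\<^sub>R h x)"
    by (subst integrable_completion) auto
qed

lemma integrable_imp_locally_integrable:
  assumes S: "S \<in> sets lebesgue" and V: "integrable (lebesgue_on S) V" and U: "U \<subseteq> S"
  shows "locally_integrable U V"
  unfolding locally_integrable_def set_integrable_def
proof (intro allI impI)
  fix K assume K: "compact K \<and> K \<subseteq> U"
  have "integrable lebesgue (\<lambda>x. indicator S x *\<^sub>R V x)"
    using V S by (simp add: integrable_restrict_space)
  then have "integrable lebesgue (\<lambda>x. indicator K x *\<^sub>R (indicator S x *\<^sub>R V x))"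
    by (rule integrable_mult_indicator[rotated]) (use K in \<open>simp add: lmeasurable_compact fmeasurableD\<close>)
  moreover have "(\<lambda>x. indicat_real K x *\<^sub>R (indicat_real S x *\<^sub>R V x)) = (\<lambda>x. indicat_real K x *\<^sub>R V x)"
    using K U by (auto simp: indicator_def fun_eq_iff)
  ultimately show "integrable lebesgue (\<lambda>x. indicat_real K x *\<^sub>R V x)" by (simp only:)
qed

text \<open>Integration by parts: the product \<open>\<psi> \<eta>\<close> is a test function, so its gradient has integral zero.\<close>

lemma has_weak_gradient_test_function:
  assumes \<Omega>: "open \<Omega>" and \<psi>: "\<psi> \<in> test_functions \<Omega>"
  shows "has_weak_gradient \<Omega> \<psi> (grad \<psi>)"
  unfolding has_weak_gradient_def
proof (intro conjI ballI)
  note D = test_functionsD[OF \<psi>]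
  show li: "locally_integrable \<Omega> \<psi>" "locally_integrable \<Omega> (grad \<psi>)"
    by (intro continuous_imp_locally_integrable smooth_imp_continuous smooth_imp_continuous_grad D(1))+
  fix \<eta> assume \<eta>: "\<eta> \<in> test_functions \<Omega>"
  note E = test_functionsD[OF \<eta>]
  have 1: "integrable (lebesgue_on \<Omega>) (\<lambda>x. \<psi> x *\<^sub>R grad \<eta> x)"
    by (rule integrable_compact_support_times_locally_integrable[OF bounded_bilinear_scaleR \<Omega>
          continuous_imp_locally_integrable[OF smooth_imp_continuous_grad[OF E(1)]]
          D(2,3) smooth_imp_continuous[OF D(1)] D(4)])
  have 2: "integrable (lebesgue_on \<Omega>) (\<lambda>x. \<eta> x *\<^sub>R grad \<psi> x)"
    by (rule integrable_compact_support_times_locally_integrable[OF bounded_bilinear_scaleR \<Omega>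
          li(2) E(2,3) smooth_imp_continuous[OF E(1)] E(4)])
  have "(\<lambda>x. \<psi> x * \<eta> x) \<in> test_functions UNIV"
    using test_functions_mult[OF \<eta> D(1)] test_functions_mono[of \<Omega> UNIV] by auto
  then have "(\<integral>x. grad (\<lambda>x. \<psi> x * \<eta> x) x \<partial>lebesgue) = 0" by (rule integral_grad_test_function)
  moreover have "grad (\<lambda>x. \<psi> x * \<eta> x) x = \<psi> x *\<^sub>R grad \<eta> x + \<eta> x *\<^sub>R grad \<psi> x" for x
    by (intro grad_mult smooth_imp_differentiable D(1) E(1))
  moreover have "\<psi> x *\<^sub>R grad \<eta> x + \<eta> x *\<^sub>R grad \<psi> x = 0" if "x \<notin> \<Omega>" for x
  proof -
    have "\<psi> x = 0" "\<eta> x = 0" using that D(3) E(3) by (blast intro: D(4) E(4))+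
    then show ?thesis by simp
  qed
  ultimately have "(\<integral>x. \<psi> x *\<^sub>R grad \<eta> x + \<eta> x *\<^sub>R grad \<psi> x \<partial>lebesgue_on \<Omega>) = 0"
    by (subst integral_lebesgue_on_eq_lebesgue(2)[OF \<Omega>]) simp_all
  then show "(\<integral>x. \<psi> x *\<^sub>R grad \<eta> x \<partial>lebesgue_on \<Omega>) = - (\<integral>x. \<eta> x *\<^sub>R grad \<psi> x \<partial>lebesgue_on \<Omega>)"
    using 1 2 by (simp add: eq_neg_iff_add_eq_0)
qed

lemma has_weak_gradient_add:
  assumes \<Omega>: "open \<Omega>" and u: "has_weak_gradient \<Omega> u Du" and v: "has_weak_gradient \<Omega> v Dv"
  shows "has_weak_gradient \<Omega> (\<lambda>x. u x + v x) (\<lambda>x. Du x + Dv x)"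
  unfolding has_weak_gradient_def
proof (intro conjI ballI)
  have li: "locally_integrable \<Omega> u" "locally_integrable \<Omega> Du" "locally_integrable \<Omega> v" "locally_integrable \<Omega> Dv"
    using u v by (auto simp: has_weak_gradient_def)
  then show "locally_integrable \<Omega> (\<lambda>x. u x + v x)" "locally_integrable \<Omega> (\<lambda>x. Du x + Dv x)"
    by (auto intro: locally_integrable_add)
  fix \<eta> assume \<eta>: "\<eta> \<in> test_functions \<Omega>"
  note E = test_functionsD[OF \<eta>]
  have 1: "integrable (lebesgue_on \<Omega>) (\<lambda>x. h x *\<^sub>R grad \<eta> x)" if "locally_integrable \<Omega> h" for h
    by (rule integrable_compact_support_times_locally_integrable[OF
          bounded_bilinear.flip[OF bounded_bilinear_scaleR] \<Omega>
          that E(2,3) smooth_imp_continuous_grad[OF E(1)] E(5)])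
  have 2: "integrable (lebesgue_on \<Omega>) (\<lambda>x. \<eta> x *\<^sub>R h x)" if "locally_integrable \<Omega> h" for h :: "'a \<Rightarrow> 'a"
    by (rule integrable_compact_support_times_locally_integrable[OF bounded_bilinear_scaleR \<Omega>
          that E(2,3) smooth_imp_continuous[OF E(1)] E(4)])
  show "(\<integral>x. (u x + v x) *\<^sub>R grad \<eta> x \<partial>lebesgue_on \<Omega>) = - (\<integral>x. \<eta> x *\<^sub>R (Du x + Dv x) \<partial>lebesgue_on \<Omega>)"
    using u v \<eta> 1[OF li(1)] 1[OF li(3)] 2[OF li(2)] 2[OF li(4)]
    by (simp add: has_weak_gradient_def scaleR_add_left scaleR_add_right)
qed

lemma has_weak_gradient_unique:
  assumes \<Omega>: "open \<Omega>" and D: "has_weak_gradient \<Omega> u D" and E: "has_weak_gradient \<Omega> u E"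
  shows "AE x in lebesgue_on \<Omega>. D x = E x"
proof -
  have li: "locally_integrable \<Omega> D" "locally_integrable \<Omega> E"
    using D E by (auto simp: has_weak_gradient_def)
  have "AE x in lebesgue_on \<Omega>. D x - E x = 0"
  proof (rule fundamental_lemma_calculus_of_variations[OF \<Omega> locally_integrable_diff[OF li]])
    fix \<eta> assume \<eta>: "\<eta> \<in> test_functions \<Omega>"
    note T = test_functionsD[OF \<eta>]
    have "integrable (lebesgue_on \<Omega>) (\<lambda>x. \<eta> x *\<^sub>R h x)" if "locally_integrable \<Omega> h" for h :: "'a \<Rightarrow> 'a"
      by (rule integrable_compact_support_times_locally_integrable[OF bounded_bilinear_scaleR \<Omega>
            that T(2,3) smooth_imp_continuous[OF T(1)] T(4)])
    from this[OF li(1)] this[OF li(2)]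
    show "(\<integral>x. \<eta> x *\<^sub>R (D x - E x) \<partial>lebesgue_on \<Omega>) = 0"
      using D E \<eta> by (simp add: has_weak_gradient_def scaleR_diff_right)
  qed
  then show ?thesis by simp
qed

lemma has_weak_gradient_wgrad:
  "has_weak_gradient \<Omega> u Du \<Longrightarrow> has_weak_gradient \<Omega> u (wgrad \<Omega> u)"
  unfolding wgrad_def by (rule someI[of "has_weak_gradient \<Omega> u"])

text \<open>Uniqueness turns additivity of weak gradients into a statement about the chosen representatives.\<close>

lemma wgrad_add_test_function:
  assumes \<Omega>: "open \<Omega>" and u: "has_weak_gradient \<Omega> u Du" and \<psi>: "\<psi> \<in> test_functions \<Omega>"
  shows "AE x in lebesgue_on \<Omega>. wgrad \<Omega> (\<lambda>x. u x + \<psi> x) x = wgrad \<Omega> u x + grad \<psi> x"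
proof -
  have "has_weak_gradient \<Omega> (\<lambda>x. u x + \<psi> x) (\<lambda>x. wgrad \<Omega> u x + grad \<psi> x)"
    by (intro has_weak_gradient_add \<Omega> has_weak_gradient_wgrad[OF u] has_weak_gradient_test_function \<psi>)
  from has_weak_gradient_unique[OF \<Omega> has_weak_gradient_wgrad[OF this] this]
  show ?thesis .
qed

section \<open>Perturbing Sobolev functions by test functions\<close>

lemma borel_measurable_lebesgue_on_AE:
  fixes f :: "'a::euclidean_space \<Rightarrow> 'b::euclidean_space"
  assumes S: "S \<in> sets lebesgue" and f: "f \<in> borel_measurable (lebesgue_on S)"
    and eq: "AE x in lebesgue_on S. f x = g x"
  shows "g \<in> borel_measurable (lebesgue_on S)"
proof -
  have "(\<lambda>x. indicator S x *\<^sub>R f x) \<in> borel_measurable lebesgue"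
    using S f by (simp add: borel_measurable_restrict_space_iff)
  moreover have "AE x in lebesgue. indicator S x *\<^sub>R f x = indicator S x *\<^sub>R g x"
    using eq S by (auto simp: AE_restrict_space_iff indicator_def elim: eventually_mono)
  ultimately have "(\<lambda>x. indicator S x *\<^sub>R g x) \<in> borel_measurable lebesgue"
    by (rule borel_measurable_AE)
  then show ?thesis using S by (simp add: borel_measurable_restrict_space_iff)
qed

lemma borel_measurable_lebesgue_on_AE_limit:
  fixes f :: "nat \<Rightarrow> 'a::euclidean_space \<Rightarrow> 'b::euclidean_space"
  assumes S: "S \<in> sets lebesgue" and f: "\<And>n. f n \<in> borel_measurable (lebesgue_on S)"
    and lim: "AE x in lebesgue_on S. (\<lambda>n. f n x) \<longlonglongrightarrow> g x"
  shows "g \<in> borel_measurable (lebesgue_on S)"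
proof (rule borel_measurable_lebesgue_on_AE[OF S])
  show "(\<lambda>x. lim (\<lambda>n. f n x)) \<in> borel_measurable (lebesgue_on S)"
    using f by (rule borel_measurable_lim_metric)
  show "AE x in lebesgue_on S. lim (\<lambda>n. f n x) = g x"
    using lim by (rule eventually_mono) (rule limI)
qed

lemma powr_add_le:
  fixes a b p :: real
  assumes "0 \<le> a" "0 \<le> b" "0 \<le> p"
  shows "(a + b) powr p \<le> 2 powr p * (a powr p + b powr p)"
proof -
  have "(a + b) powr p \<le> (2 * max a b) powr p"
    using assms by (intro powr_mono2) auto
  also have "\<dots> = 2 powr p * max a b powr p"
    by (rule powr_mult)
  also have "max a b powr p \<le> a powr p + b powr p" by (auto simp: max_def)
  finally show ?thesis by simp
qed

lemma in_Lp_bound: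
  assumes f: "in_Lp \<Omega> p f" and g: "g \<in> borel_measurable (lebesgue_on \<Omega>)"
    and le: "AE x in lebesgue_on \<Omega>. norm (g x) \<le> norm (f x)" and p: "0 \<le> p"
  shows "in_Lp \<Omega> p g"
  unfolding in_Lp_def
proof (rule conjI[OF g Bochner_Integration.integrable_bound])
  show "integrable (lebesgue_on \<Omega>) (\<lambda>x. norm (f x) powr p)" using f by (simp add: in_Lp_def)
  show "(\<lambda>x. norm (g x) powr p) \<in> borel_measurable (lebesgue_on \<Omega>)" using g by measurable
  show "AE x in lebesgue_on \<Omega>. norm (norm (g x) powr p) \<le> norm (norm (f x) powr p)"
    using le by eventually_elim (use p in \<open>auto intro: powr_mono2\<close>)
qed

lemma in_Lp_add:
  assumes f: "in_Lp \<Omega> p f" and g: "in_Lp \<Omega> p g" and p: "0 \<le> p"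
  shows "in_Lp \<Omega> p (\<lambda>x. f x + g x)"
  unfolding in_Lp_def
proof (rule conjI[OF _ Bochner_Integration.integrable_bound])
  show meas: "(\<lambda>x. f x + g x) \<in> borel_measurable (lebesgue_on \<Omega>)"
    using f g by (auto simp: in_Lp_def)
  show "integrable (lebesgue_on \<Omega>) (\<lambda>x. 2 powr p * (norm (f x) powr p + norm (g x) powr p))"
    using f g by (auto simp: in_Lp_def)
  show "(\<lambda>x. norm (f x + g x) powr p) \<in> borel_measurable (lebesgue_on \<Omega>)"
    using meas by measurable
  have "norm (f x + g x) powr p \<le> 2 powr p * (norm (f x) powr p + norm (g x) powr p)" for x
  proof -
    have "norm (f x + g x) powr p \<le> (norm (f x) + norm (g x)) powr p"
      using p by (intro powr_mono2) (auto intro: norm_triangle_ineq)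
    also have "\<dots> \<le> 2 powr p * (norm (f x) powr p + norm (g x) powr p)"
      by (rule powr_add_le[OF norm_ge_zero norm_ge_zero p])
    finally show ?thesis .
  qed
  then show "AE x in lebesgue_on \<Omega>. norm (norm (f x + g x) powr p)
      \<le> norm (2 powr p * (norm (f x) powr p + norm (g x) powr p))"
    by (intro AE_I2) simp
qed

lemma in_Lp_scaleR:
  assumes f: "in_Lp \<Omega> p f"
  shows "in_Lp \<Omega> p (\<lambda>x. c *\<^sub>R f x)"
  using f by (auto simp: in_Lp_def powr_mult)

lemma in_Lp_AE_eq:
  fixes f g :: "'a::euclidean_space \<Rightarrow> 'b::euclidean_space"
  assumes f: "in_Lp \<Omega> p f" and \<Omega>: "open \<Omega>" and eq: "AE x in lebesgue_on \<Omega>. f x = g x" and p: "0 \<le> p"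
  shows "in_Lp \<Omega> p g"
proof (rule in_Lp_bound[OF f _ _ p])
  show "g \<in> borel_measurable (lebesgue_on \<Omega>)"
    using f \<Omega> by (intro borel_measurable_lebesgue_on_AE[OF _ _ eq]) (auto simp: in_Lp_def)
  show "AE x in lebesgue_on \<Omega>. norm (g x) \<le> norm (f x)"
    using eq by eventually_elim simp
qed

lemma in_Lp_const:
  assumes "S \<in> lmeasurable"
  shows "in_Lp S p (\<lambda>x. c)"
proof -
  interpret finite_measure "lebesgue_on S" by (rule finite_measure_lebesgue_on[OF assms])
  show ?thesis by (simp add: in_Lp_def)
qed

lemma in_Lp_compact_support:
  fixes h :: "'a::euclidean_space \<Rightarrow> 'b::euclidean_space"
  assumes \<Omega>: "open \<Omega>" and K: "compact K" and h: "continuous_on UNIV h"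
    and 0: "\<And>x. x \<notin> K \<Longrightarrow> h x = 0" and p: "0 < p"
  shows "in_Lp \<Omega> p h"
  unfolding in_Lp_def
proof
  have "h \<in> borel_measurable borel" using h by (rule borel_measurable_continuous_onI)
  then show "h \<in> borel_measurable (lebesgue_on \<Omega>)"
    by (intro measurable_restrict_space1 measurable_completion) simp
  have cont: "continuous_on K (\<lambda>x. norm (h x) powr p)"
    using h p by (intro continuous_on_powr' continuous_intros) (auto intro: continuous_on_subset)
  have "(\<lambda>x. indicator K x *\<^sub>R (norm (h x) powr p)) = (\<lambda>x. norm (h x) powr p)"
    by (rule scaleR_indicator_cancel) (simp add: 0)
  with borel_integrable_compact[OF K cont] have lborel: "integrable lborel (\<lambda>x. norm (h x) powr p)"
    by (simp only:)
  then have "integrable lebesgue (\<lambda>x. norm (h x) powr p)"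
    by (subst integrable_completion) auto
  then have "integrable lebesgue (\<lambda>x. indicator \<Omega> x *\<^sub>R (norm (h x) powr p))"
    by (rule integrable_mult_indicator[rotated]) (use \<Omega> in simp)
  then show "integrable (lebesgue_on \<Omega>) (\<lambda>x. norm (h x) powr p)"
    using \<Omega> by (simp add: integrable_restrict_space)
qed

lemma W1p_D:
  assumes "u \<in> W1p \<Omega> p"
  shows "in_Lp \<Omega> p u" "has_weak_gradient \<Omega> u (wgrad \<Omega> u)" "in_Lp \<Omega> p (wgrad \<Omega> u)"
  using assms by (auto simp: W1p_def intro: has_weak_gradient_wgrad)

lemma W1p_add_test_function:
  assumes \<Omega>: "open \<Omega>" and u: "u \<in> W1p \<Omega> p" and \<psi>: "\<psi> \<in> test_functions \<Omega>" and p: "0 < p"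
  shows "(\<lambda>x. u x + \<psi> x) \<in> W1p \<Omega> p"
proof -
  note D = test_functionsD[OF \<psi>] and U = W1p_D[OF u]
  have "in_Lp \<Omega> p (\<lambda>x. u x + \<psi> x)"
    using p by (intro in_Lp_add U(1) in_Lp_compact_support[OF \<Omega> D(2) smooth_imp_continuous[OF D(1)] D(4)]) auto
  moreover have "has_weak_gradient \<Omega> (\<lambda>x. u x + \<psi> x) (\<lambda>x. wgrad \<Omega> u x + grad \<psi> x)"
    by (intro has_weak_gradient_add \<Omega> U(2) has_weak_gradient_test_function \<psi>)
  moreover have "in_Lp \<Omega> p (\<lambda>x. wgrad \<Omega> u x + grad \<psi> x)"
    using p by (intro in_Lp_add U(3)
      in_Lp_compact_support[OF \<Omega> D(2) smooth_imp_continuous_grad[OF D(1)] D(5)]) auto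
  then have "in_Lp \<Omega> p (wgrad \<Omega> (\<lambda>x. u x + \<psi> x))"
    by (rule in_Lp_AE_eq[OF _ \<Omega>])
      (use wgrad_add_test_function[OF \<Omega> U(2) \<psi>] p in \<open>auto elim: eventually_mono\<close>)
  ultimately show ?thesis by (auto simp: W1p_def)
qed

text \<open>
  The sequence that approximates \<open>u\<close> is shifted by \<open>\<psi>\<close>. Up to null sets this changes neither the
  differences of functions nor those of weak gradients, and on the boundary \<open>\<psi>\<close> is zero.
\<close>

lemma has_trace_add_test_function:
  assumes \<Omega>: "open \<Omega>" and u: "has_trace \<Omega> p u g" and \<psi>: "\<psi> \<in> test_functions \<Omega>" and p: "0 < p"
  shows "has_trace \<Omega> p (\<lambda>x. u x + \<psi> x) g"
proof -
  note D = test_functionsD[OF \<psi>]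
  from u obtain w where uW: "u \<in> W1p \<Omega> p" and g: "g \<in> borel_measurable (surface_measure \<Omega>)"
    and w: "\<And>k. w k \<in> W1p \<Omega> p" "\<And>k. continuous_on (closure \<Omega>) (w k)"
    and lim: "(\<lambda>k. \<integral>x. \<bar>w k x - u x\<bar> powr p \<partial>lebesgue_on \<Omega>) \<longlonglongrightarrow> 0"
      "(\<lambda>k. \<integral>x. norm (wgrad \<Omega> (w k) x - wgrad \<Omega> u x) powr p \<partial>lebesgue_on \<Omega>) \<longlonglongrightarrow> 0"
      "(\<lambda>k. \<integral>\<^sup>+x. ennreal (\<bar>w k x - g x\<bar> powr p) \<partial>surface_measure \<Omega>) \<longlonglongrightarrow> 0"
    unfolding has_trace_def by auto
  let ?w = "\<lambda>k x. w k x + \<psi> x" and ?u = "\<lambda>x. u x + \<psi> x"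
  note W = W1p_add_test_function[OF \<Omega> _ \<psi> p]
  have "(\<integral>x. norm (wgrad \<Omega> (?w k) x - wgrad \<Omega> ?u x) powr p \<partial>lebesgue_on \<Omega>) =
    (\<integral>x. norm (wgrad \<Omega> (w k) x - wgrad \<Omega> u x) powr p \<partial>lebesgue_on \<Omega>)" for k
  proof (rule integral_cong_AE)
    have [measurable]: "wgrad \<Omega> v \<in> borel_measurable (lebesgue_on \<Omega>)" if "v \<in> W1p \<Omega> p" for v
      using W1p_D(3)[OF that] by (simp add: in_Lp_def)
    note [measurable] = this[OF W[OF w(1)[of k]]] this[OF W[OF uW]] this[OF w(1)[of k]] this[OF uW]
    show "(\<lambda>x. norm (wgrad \<Omega> (?w k) x - wgrad \<Omega> ?u x) powr p) \<in> borel_measurable (lebesgue_on \<Omega>)"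
      by measurable
    show "(\<lambda>x. norm (wgrad \<Omega> (w k) x - wgrad \<Omega> u x) powr p) \<in> borel_measurable (lebesgue_on \<Omega>)"
      by measurable
    show "AE x in lebesgue_on \<Omega>. norm (wgrad \<Omega> (?w k) x - wgrad \<Omega> ?u x) powr p =
      norm (wgrad \<Omega> (w k) x - wgrad \<Omega> u x) powr p"
      using wgrad_add_test_function[OF \<Omega> W1p_D(2)[OF w(1)[of k]] \<psi>]
        wgrad_add_test_function[OF \<Omega> W1p_D(2)[OF uW] \<psi>]
      by eventually_elim simp
  qed
  moreover have "(\<integral>\<^sup>+x. ennreal (\<bar>?w k x - g x\<bar> powr p) \<partial>surface_measure \<Omega>) =
    (\<integral>\<^sup>+x. ennreal (\<bar>w k x - g x\<bar> powr p) \<partial>surface_measure \<Omega>)" for k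
  proof (rule nn_integral_cong)
    fix x assume "x \<in> space (surface_measure \<Omega>)"
    then have "x \<in> frontier \<Omega>" by (simp add: surface_measure_def space_restrict_space)
    then have "x \<notin> \<Omega>" using \<Omega> by (simp add: frontier_def interior_open)
    then have "\<psi> x = 0" using D(3) by (blast intro: D(4))
    then show "ennreal (\<bar>?w k x - g x\<bar> powr p) = ennreal (\<bar>w k x - g x\<bar> powr p)" by simp
  qed
  ultimately show ?thesis
    unfolding has_trace_def
    using lim g w uW
    by (intro conjI exI[of _ ?w] allI W continuous_on_add smooth_imp_continuous[OF D(1)]) simp_all
qed

lemma W1p_bdry_add_test_function:
  assumes \<Omega>: "open \<Omega>" and u: "u \<in> W1p_bdry \<Omega> p \<phi>" and \<psi>: "\<psi> \<in> test_functions \<Omega>" and p: "0 < p"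
  shows "(\<lambda>x. u x + \<psi> x) \<in> W1p_bdry \<Omega> p \<phi>"
  using u W1p_add_test_function[OF \<Omega> _ \<psi> p] has_trace_add_test_function[OF \<Omega> _ \<psi> p]
  by (auto simp: W1p_bdry_def)

section \<open>Difference quotients of convex integrands\<close>

text \<open>
  With \<open>t = 1 / (n + 1)\<close>, the upper bound is convexity between \<open>\<xi>\<close> and \<open>\<xi> + \<eta>\<close>, in which
  \<open>\<xi> + t \<eta>\<close> lies. For the lower bound, \<open>\<xi>\<close> itself lies between \<open>\<xi> + t \<eta>\<close> and \<open>\<xi> - \<eta>\<close>, with
  weights \<open>1 / (1 + t)\<close> and \<open>t / (1 + t)\<close>.
\<close>

lemma convex_quotient_bound:
  fixes \<Phi> :: "'b::real_vector \<Rightarrow> real"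
  assumes \<Phi>: "convex_on UNIV \<Phi>" "\<And>\<xi>. 0 \<le> \<Phi> \<xi>"
  shows "\<bar>(\<Phi> (\<xi> + inverse (real (Suc n)) *\<^sub>R \<eta>) - \<Phi> \<xi>) * real (Suc n)\<bar>
      \<le> \<Phi> (\<xi> + \<eta>) + \<Phi> (\<xi> - \<eta>) + 2 * \<Phi> \<xi>"
proof -
  define N where "N = real (Suc n)"
  have N: "1 \<le> N" by (simp add: N_def)
  let ?\<zeta> = "\<xi> + inverse N *\<^sub>R \<eta>"
  have "?\<zeta> = (1 - inverse N) *\<^sub>R \<xi> + inverse N *\<^sub>R (\<xi> + \<eta>)"
    by (simp add: algebra_simps)
  then have "\<Phi> ?\<zeta> \<le> (1 - inverse N) * \<Phi> \<xi> + inverse N * \<Phi> (\<xi> + \<eta>)"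
    using convex_onD[OF \<Phi>(1), of "inverse N" \<xi> "\<xi> + \<eta>"] N by (simp add: inverse_le_1_iff)
  then have "N * \<Phi> ?\<zeta> \<le> N * ((1 - inverse N) * \<Phi> \<xi> + inverse N * \<Phi> (\<xi> + \<eta>))"
    using N by (intro mult_left_mono) auto
  also have "\<dots> = (N - 1) * \<Phi> \<xi> + \<Phi> (\<xi> + \<eta>)"
    using N by (simp add: field_simps)
  finally have upper: "(\<Phi> ?\<zeta> - \<Phi> \<xi>) * N \<le> \<Phi> (\<xi> + \<eta>) - \<Phi> \<xi>"
    by (simp add: algebra_simps)
  \<comment> \<open>Here \<open>1 / (N + 1)\<close> is the weight \<open>t / (1 + t)\<close> for \<open>t = 1 / N\<close>.\<close>
  have coeff: "1 - inverse (N + 1) = N * inverse (N + 1)"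
    using N by (simp add: field_simps)
  have "(1 - inverse (N + 1)) *\<^sub>R ?\<zeta> + inverse (N + 1) *\<^sub>R (\<xi> - \<eta>)
      = ((1 - inverse (N + 1)) + inverse (N + 1)) *\<^sub>R \<xi> + ((1 - inverse (N + 1)) * inverse N - inverse (N + 1)) *\<^sub>R \<eta>"
    by (simp only: scaleR_add_right scaleR_add_left scaleR_diff_right scaleR_diff_left scaleR_scaleR) simp
  also have "(1 - inverse (N + 1)) * inverse N - inverse (N + 1) = 0"
    unfolding coeff using N by simp
  finally have "(1 - inverse (N + 1)) *\<^sub>R ?\<zeta> + inverse (N + 1) *\<^sub>R (\<xi> - \<eta>) = \<xi>" by simp
  then have "\<Phi> \<xi> \<le> N * inverse (N + 1) * \<Phi> ?\<zeta> + inverse (N + 1) * \<Phi> (\<xi> - \<eta>)"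
    using convex_onD[OF \<Phi>(1), of "inverse (N + 1)" ?\<zeta> "\<xi> - \<eta>"] N coeff
    by (simp add: inverse_le_1_iff)
  then have "(N + 1) * \<Phi> \<xi> \<le> (N + 1) * (N * inverse (N + 1) * \<Phi> ?\<zeta> + inverse (N + 1) * \<Phi> (\<xi> - \<eta>))"
    using N by (intro mult_left_mono) auto
  also have "\<dots> = N * \<Phi> ?\<zeta> + \<Phi> (\<xi> - \<eta>)"
  proof -
    have "(N + 1) * inverse (N + 1) = 1" using N by simp
    then show ?thesis by algebra
  qed
  finally have lower: "\<Phi> \<xi> - \<Phi> (\<xi> - \<eta>) \<le> (\<Phi> ?\<zeta> - \<Phi> \<xi>) * N"
    by (simp add: algebra_simps)
  from upper lower show ?thesis
    unfolding N_def[symmetric]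
    using \<Phi>(2)[of \<xi>] \<Phi>(2)[of "\<xi> + \<eta>"] \<Phi>(2)[of "\<xi> - \<eta>"] by linarith
qed

text \<open>
  The positive part is convex and the power is convex and increasing on \<open>[0, \<infinity>)\<close>. At the end
  point \<open>0\<close> convexity of the power reduces to \<open>t\<^sup>m \<le> t\<close> for \<open>0 \<le> t \<le> 1\<close>.
\<close>

lemma convex_on_max_0_powr:
  fixes m :: real
  assumes m: "1 \<le> m"
  shows "convex_on UNIV (\<lambda>s::real. max s 0 powr m)"
proof (rule convex_onI)
  have scale: "(t * x) powr m \<le> t * x powr m" if "0 \<le> t" "t \<le> 1" "0 \<le> x" for t x :: real
  proof -
    have "t powr m \<le> t powr 1" using that m by (intro powr_mono') auto
    then have "t powr m * x powr m \<le> t * x powr m"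
      using that by (intro mult_right_mono) auto
    then show ?thesis using that by (simp add: powr_mult)
  qed
  have pos: "((1 - t) * x + t * y) powr m \<le> (1 - t) * x powr m + t * y powr m"
    if "0 < t" "t < 1" "0 \<le> x" "0 \<le> y" for t x y :: real
  proof -
    from that have "x = 0 \<or> y = 0 \<or> 0 < x \<and> 0 < y" by linarith
    then consider "x = 0" | "y = 0" | "0 < x" "0 < y" by blast
    then show ?thesis
    proof cases
      case 1
      then show ?thesis using scale[of t y] that m by simp
    next
      case 2
      then show ?thesis using scale[of "1 - t" x] that m by simp
    next
      case 3
      then show ?thesis
        using convex_onD[OF powr_convex[OF m], of t x y] that by simp
    qed
  qed
  fix t x y :: real assume t: "0 < t" "t < 1"
  have "max ((1 - t) *\<^sub>R x + t *\<^sub>R y) 0 \<le> (1 - t) * max x 0 + t * max y 0"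
    using t by (auto intro!: add_mono mult_left_mono add_nonneg_nonneg mult_nonneg_nonneg)
  then have "max ((1 - t) *\<^sub>R x + t *\<^sub>R y) 0 powr m \<le> ((1 - t) * max x 0 + t * max y 0) powr m"
    using m by (intro powr_mono2) auto
  also have "\<dots> \<le> (1 - t) * max x 0 powr m + t * max y 0 powr m"
    using t by (intro pos) auto
  finally show "max ((1 - t) *\<^sub>R x + t *\<^sub>R y) 0 powr m
      \<le> (1 - t) * max x 0 powr m + t * max y 0 powr m" .
qed auto

lemma strictly_convex_imp_convex_on: "strictly_convex \<Phi> \<Longrightarrow> convex_on UNIV \<Phi>"
proof (rule convex_onI)
  fix t :: real and x y :: 'a assume "strictly_convex \<Phi>" "0 < t" "t < 1"
  then show "\<Phi> ((1 - t) *\<^sub>R x + t *\<^sub>R y) \<le> (1 - t) * \<Phi> x + t * \<Phi> y"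
    by (cases "x = y") (auto simp: strictly_convex_def less_imp_le scaleR_left_diff_distrib algebra_simps)
qed auto

text \<open>
  Dominated convergence, with the majorant from the convex bound on the quotients. The
  limit is prescribed for the quotients along \<open>\<eta>\<close>, rather than as a derivative of \<open>\<Phi> x\<close>, because
  \<open>s \<mapsto> (s\<^sup>+)\<^sup>m\<close> has a corner at \<open>0\<close> when \<open>m = 1\<close>. The bounded factor \<open>f\<close> may change sign, which
  is why it is kept apart from the convex integrand.
\<close>

lemma first_variation_convex_integrand:
  fixes \<Phi> :: "'a::euclidean_space \<Rightarrow> 'b::euclidean_space \<Rightarrow> real"
  assumes S: "S \<in> sets lebesgue"
    and convex: "AE x in lebesgue_on S. convex_on UNIV (\<Phi> x) \<and> (\<forall>\<xi>. 0 \<le> \<Phi> x \<xi>)"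
    and int: "\<And>c. integrable (lebesgue_on S) (\<lambda>x. \<Phi> x (D x + c *\<^sub>R \<eta> x))"
    and lim: "AE x in lebesgue_on S.
      (\<lambda>n. (\<Phi> x (D x + inverse (real (Suc n)) *\<^sub>R \<eta> x) - \<Phi> x (D x)) * real (Suc n)) \<longlonglongrightarrow> V x"
    and f: "f \<in> borel_measurable (lebesgue_on S)" "AE x in lebesgue_on S. \<bar>f x\<bar> \<le> K"
  shows "integrable (lebesgue_on S) (\<lambda>x. f x * V x)" (is ?int)
    and "(\<lambda>n. \<integral>x. f x * ((\<Phi> x (D x + inverse (real (Suc n)) *\<^sub>R \<eta> x) - \<Phi> x (D x)) * real (Suc n)) \<partial>lebesgue_on S)
      \<longlonglongrightarrow> (\<integral>x. f x * V x \<partial>lebesgue_on S)" (is ?lim)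
proof -
  let ?q = "\<lambda>n x. (\<Phi> x (D x + inverse (real (Suc n)) *\<^sub>R \<eta> x) - \<Phi> x (D x)) * real (Suc n)"
  let ?w = "\<lambda>x. K * (\<Phi> x (D x + \<eta> x) + \<Phi> x (D x - \<eta> x) + 2 * \<Phi> x (D x))"
  have int0: "integrable (lebesgue_on S) (\<lambda>x. \<Phi> x (D x))"
    and int1: "integrable (lebesgue_on S) (\<lambda>x. \<Phi> x (D x + \<eta> x))"
    and int2: "integrable (lebesgue_on S) (\<lambda>x. \<Phi> x (D x - \<eta> x))"
    using int[of 0] int[of 1] int[of "-1"] by simp_all
  have "(\<lambda>x. ?q n x) \<in> borel_measurable (lebesgue_on S)" for n
    by (intro borel_measurable_times borel_measurable_diff borel_measurable_const
        borel_measurable_integrable[OF int] borel_measurable_integrable[OF int0])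
  then have qm: "(\<lambda>x. f x * ?q n x) \<in> borel_measurable (lebesgue_on S)" for n
    using f(1) by (rule borel_measurable_times[rotated])
  have lim': "AE x in lebesgue_on S. (\<lambda>n. f x * ?q n x) \<longlonglongrightarrow> f x * V x"
    using lim by eventually_elim (rule tendsto_mult_left)
  have Vm: "(\<lambda>x. f x * V x) \<in> borel_measurable (lebesgue_on S)"
    by (rule borel_measurable_lebesgue_on_AE_limit[OF S qm lim'])
  have w: "integrable (lebesgue_on S) ?w"
    by (intro integrable_mult_right Bochner_Integration.integrable_add int0 int1 int2)
  have bound: "AE x in lebesgue_on S. norm (f x * ?q n x) \<le> ?w x" for n
    using convex f(2)
  proof eventually_elim
    case (elim x)
    then have "\<bar>?q n x\<bar> \<le> \<Phi> x (D x + \<eta> x) + \<Phi> x (D x - \<eta> x) + 2 * \<Phi> x (D x)"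
      by (intro convex_quotient_bound) auto
    with elim show ?case
      unfolding real_norm_def abs_mult[of "f x"] by (intro mult_mono) auto
  qed
  show ?int by (rule integrable_dominated_convergence[OF Vm qm w lim' bound])
  show ?lim by (rule integral_dominated_convergence[OF Vm qm w lim' bound])
qed

text \<open>
  For simple functions in place of \<open>D\<close> the composition is patched together from finitely many
  measurable pieces. The general case is their limit, by continuity in the second argument.
\<close>

lemma caratheodory_composition_measurable:
  fixes G :: "'a::euclidean_space \<Rightarrow> 'b::euclidean_space \<Rightarrow> real"
  assumes S: "S \<in> sets lebesgue"
    and meas: "\<And>\<xi>. (\<lambda>x. G x \<xi>) \<in> borel_measurable (lebesgue_on S)"
    and cont: "AE x in lebesgue_on S. continuous_on UNIV (G x)"
    and D: "D \<in> borel_measurable (lebesgue_on S)"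
  shows "(\<lambda>x. G x (D x)) \<in> borel_measurable (lebesgue_on S)"
proof -
  obtain s where s: "\<And>i. simple_function (lebesgue_on S) (s i)"
      "\<And>x. x \<in> space (lebesgue_on S) \<Longrightarrow> (\<lambda>i. s i x) \<longlonglongrightarrow> D x"
    using borel_measurable_implies_sequence_metric[OF D, of 0] by blast
  show ?thesis
  proof (rule borel_measurable_lebesgue_on_AE_limit[OF S])
    fix i
    have fin: "finite (s i ` space (lebesgue_on S))" by (rule simple_functionD(1)[OF s(1)])
    show "(\<lambda>x. G x (s i x)) \<in> borel_measurable (lebesgue_on S)"
    proof (rule measurable_compose_countable'[where f = "\<lambda>\<xi> x. G x \<xi>" and g = "s i", OF meas])
      show "s i \<in> measurable (lebesgue_on S) (count_space (s i ` space (lebesgue_on S)))"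
        using s(1)[of i] by (auto simp: measurable_count_space_eq2 simple_function_def)
      show "countable (s i ` space (lebesgue_on S))" using fin by (rule countable_finite)
    qed
  next
    show "AE x in lebesgue_on S. (\<lambda>i. G x (s i x)) \<longlonglongrightarrow> G x (D x)"
      using cont AE_space
    proof eventually_elim
      case (elim x)
      then have "isCont (G x) (D x)" by (simp add: continuous_on_eq_continuous_at)
      with s(2)[OF elim(2)] show ?case by (rule isCont_tendsto_compose[rotated])
    qed
  qed
qed

lemma integrable_growth_composition:
  fixes G :: "'a::euclidean_space \<Rightarrow> 'b::euclidean_space \<Rightarrow> real"
  assumes S: "S \<in> sets lebesgue"
    and meas: "\<And>\<xi>. (\<lambda>x. G x \<xi>) \<in> borel_measurable (lebesgue_on S)"
    and cont: "AE x in lebesgue_on S. continuous_on UNIV (G x)"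
    and growth: "\<And>x \<xi>. x \<in> S \<Longrightarrow> \<bar>G x \<xi>\<bar> \<le> C * norm \<xi> powr p"
    and D: "in_Lp S p D"
  shows "integrable (lebesgue_on S) (\<lambda>x. G x (D x))"
proof (rule Bochner_Integration.integrable_bound)
  show "integrable (lebesgue_on S) (\<lambda>x. C * norm (D x) powr p)"
    using D by (simp add: in_Lp_def)
  show "(\<lambda>x. G x (D x)) \<in> borel_measurable (lebesgue_on S)"
    using D by (intro caratheodory_composition_measurable[OF S meas cont]) (simp add: in_Lp_def)
  show "AE x in lebesgue_on S. norm (G x (D x)) \<le> norm (C * norm (D x) powr p)"
  proof (rule AE_I2)
    fix x assume "x \<in> space (lebesgue_on S)"
    then show "norm (G x (D x)) \<le> norm (C * norm (D x) powr p)"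
      using growth[of x "D x"] by simp
  qed
qed

lemma integrable_max_0_powr:
  assumes S: "S \<in> lmeasurable" and u: "in_Lp S p u" and m: "0 \<le> m" "m \<le> p"
  shows "integrable (lebesgue_on S) (\<lambda>x. max (u x) 0 powr m)"
proof (rule Bochner_Integration.integrable_bound)
  interpret finite_measure "lebesgue_on S" by (rule finite_measure_lebesgue_on[OF S])
  show "integrable (lebesgue_on S) (\<lambda>x. 1 + norm (u x) powr p)"
    using u by (auto simp: in_Lp_def)
  have "u \<in> borel_measurable (lebesgue_on S)" using u by (simp add: in_Lp_def)
  then show "(\<lambda>x. max (u x) 0 powr m) \<in> borel_measurable (lebesgue_on S)" by measurable
  have "max s 0 powr m \<le> 1 + \<bar>s\<bar> powr p" for s :: real
  proof (cases "\<bar>s\<bar> \<le> 1")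
    case True
    then have "max s 0 powr m \<le> 1" using m by (intro powr_le1) auto
    then show ?thesis by (smt (verit) powr_ge_zero)
  next
    case False
    have "max s 0 powr m \<le> \<bar>s\<bar> powr m" using m by (intro powr_mono2) auto
    also have "\<dots> \<le> \<bar>s\<bar> powr p" using False m by (intro powr_mono) auto
    finally show ?thesis by simp
  qed
  then show "AE x in lebesgue_on S. norm (max (u x) 0 powr m) \<le> norm (1 + norm (u x) powr p)"
    by (intro AE_I2) (smt (verit) powr_ge_zero real_norm_def)
qed

section \<open>The first variation of the energy\<close>

lemma gradient_energy_first_variation:
  fixes G :: "'a::euclidean_space \<Rightarrow> 'b::euclidean_space \<Rightarrow> real"
  assumes S: "S \<in> sets lebesgue"
    and meas: "\<And>\<xi>. (\<lambda>x. G x \<xi>) \<in> borel_measurable (lebesgue_on S)"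
    and convex: "AE x in lebesgue_on S. convex_on UNIV (G x) \<and> (\<forall>\<xi>. G x differentiable (at \<xi>))"
    and growth: "\<And>x \<xi>. x \<in> S \<Longrightarrow> 0 \<le> G x \<xi> \<and> G x \<xi> \<le> C * norm \<xi> powr p"
    and p: "0 \<le> p" and D: "in_Lp S p D" and \<eta>: "in_Lp S p \<eta>"
  shows "\<And>c. integrable (lebesgue_on S) (\<lambda>x. G x (D x + c *\<^sub>R \<eta> x))"
    and "integrable (lebesgue_on S) (\<lambda>x. \<eta> x \<bullet> grad (G x) (D x))"
    and "(\<lambda>n. \<integral>x. (G x (D x + inverse (real (Suc n)) *\<^sub>R \<eta> x) - G x (D x)) * real (Suc n) \<partial>lebesgue_on S)
      \<longlonglongrightarrow> (\<integral>x. \<eta> x \<bullet> grad (G x) (D x) \<partial>lebesgue_on S)"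
proof -
  have cont: "AE x in lebesgue_on S. continuous_on UNIV (G x)"
    using convex by eventually_elim
      (auto intro!: differentiable_imp_continuous_on simp: differentiable_on_def)
  show int: "integrable (lebesgue_on S) (\<lambda>x. G x (D x + c *\<^sub>R \<eta> x))" for c
  proof (rule integrable_growth_composition[OF S meas cont])
    show "\<bar>G x \<xi>\<bar> \<le> C * norm \<xi> powr p" if "x \<in> S" for x \<xi>
      using growth[OF that, of \<xi>] by simp
    show "in_Lp S p (\<lambda>x. D x + c *\<^sub>R \<eta> x)" by (intro in_Lp_add in_Lp_scaleR D \<eta> p)
  qed
  have convex': "AE x in lebesgue_on S. convex_on UNIV (G x) \<and> (\<forall>\<xi>. 0 \<le> G x \<xi>)"
    using convex AE_space by eventually_elim (use growth S in auto)
  have lim: "AE x in lebesgue_on S. (\<lambda>n. (G x (D x + inverse (real (Suc n)) *\<^sub>R \<eta> x) - G x (D x)) * real (Suc n))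
      \<longlonglongrightarrow> \<eta> x \<bullet> grad (G x) (D x)"
    using convex
  proof eventually_elim
    case (elim x)
    then show ?case by (intro directional_quotient_tendsto has_derivative_grad) auto
  qed
  show "integrable (lebesgue_on S) (\<lambda>x. \<eta> x \<bullet> grad (G x) (D x))"
    and "(\<lambda>n. \<integral>x. (G x (D x + inverse (real (Suc n)) *\<^sub>R \<eta> x) - G x (D x)) * real (Suc n) \<partial>lebesgue_on S)
      \<longlonglongrightarrow> (\<integral>x. \<eta> x \<bullet> grad (G x) (D x) \<partial>lebesgue_on S)"
    using first_variation_convex_integrand[OF S convex' int lim, of "\<lambda>x. 1" 1] by simp_all
qed

text \<open>The directions are the constant functions \<open>b\<close>, which lie in \<open>L\<^sup>p\<close> because \<open>S\<close> has finite measure.\<close>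

lemma integrable_grad_composition:
  fixes G :: "'a::euclidean_space \<Rightarrow> 'b::euclidean_space \<Rightarrow> real"
  assumes S: "S \<in> lmeasurable"
    and meas: "\<And>\<xi>. (\<lambda>x. G x \<xi>) \<in> borel_measurable (lebesgue_on S)"
    and convex: "AE x in lebesgue_on S. convex_on UNIV (G x) \<and> (\<forall>\<xi>. G x differentiable (at \<xi>))"
    and growth: "\<And>x \<xi>. x \<in> S \<Longrightarrow> 0 \<le> G x \<xi> \<and> G x \<xi> \<le> C * norm \<xi> powr p"
    and p: "0 \<le> p" and D: "in_Lp S p D"
  shows "integrable (lebesgue_on S) (\<lambda>x. grad (G x) (D x))"
proof -
  have "integrable (lebesgue_on S) (\<lambda>x. b \<bullet> grad (G x) (D x))" for b
    by (rule gradient_energy_first_variation(2)[OF fmeasurableD[OF S] meas convex growth p D in_Lp_const[OF S]])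
  then have "integrable (lebesgue_on S) (\<lambda>x. \<Sum>b\<in>Basis. (b \<bullet> grad (G x) (D x)) *\<^sub>R b)"
    by (intro Bochner_Integration.integrable_sum integrable_scaleR_left)
  then show ?thesis by (simp add: inner_commute[of _ "grad _ _"] euclidean_representation)
qed

text \<open>
  The quotients of \<open>s \<mapsto> (s\<^sup>+)\<^sup>m\<close> are identically zero where \<open>\<psi>\<close> vanishes; elsewhere \<open>u > 0\<close>, and there
  the function is the smooth power \<open>s\<^sup>m\<close>.
\<close>

lemma lower_order_first_variation:
  fixes u \<psi> f :: "'a::euclidean_space \<Rightarrow> real"
  assumes S: "S \<in> lmeasurable" and m: "1 \<le> m" "m \<le> p"
    and u: "in_Lp S p u" and \<psi>: "in_Lp S p \<psi>" "\<And>x. x \<in> S \<Longrightarrow> \<psi> x \<noteq> 0 \<Longrightarrow> 0 < u x"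
    and f: "f \<in> borel_measurable (lebesgue_on S)" "\<And>x. x \<in> S \<Longrightarrow> \<bar>f x\<bar> \<le> K"
  shows "integrable (lebesgue_on S) (\<lambda>x. f x * (m * u x powr (m - 1) * \<psi> x))"
    and "(\<lambda>n. \<integral>x. f x * ((max (u x + inverse (real (Suc n)) * \<psi> x) 0 powr m - max (u x) 0 powr m) * real (Suc n)) \<partial>lebesgue_on S)
      \<longlonglongrightarrow> (\<integral>x. f x * (m * u x powr (m - 1) * \<psi> x) \<partial>lebesgue_on S)"
proof -
  let ?h = "\<lambda>s::real. max s 0 powr m"
  have S': "S \<in> sets lebesgue" using S by (rule fmeasurableD)
  have 1: "AE x in lebesgue_on S. convex_on UNIV ?h \<and> (\<forall>\<xi>. 0 \<le> ?h \<xi>)"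
    using convex_on_max_0_powr[OF m(1)] by simp
  have 2: "integrable (lebesgue_on S) (\<lambda>x. ?h (u x + c *\<^sub>R \<psi> x))" for c
    using m by (intro integrable_max_0_powr[OF S, of p] in_Lp_add in_Lp_scaleR u \<psi>(1)) auto
  have 3: "AE x in lebesgue_on S. (\<lambda>n. (?h (u x + inverse (real (Suc n)) *\<^sub>R \<psi> x) - ?h (u x)) * real (Suc n))
      \<longlonglongrightarrow> m * u x powr (m - 1) * \<psi> x"
  proof (rule AE_I2)
    fix x assume "x \<in> space (lebesgue_on S)"
    then have x: "x \<in> S" by simp
    show "(\<lambda>n. (?h (u x + inverse (real (Suc n)) *\<^sub>R \<psi> x) - ?h (u x)) * real (Suc n))
      \<longlonglongrightarrow> m * u x powr (m - 1) * \<psi> x"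
    proof (cases "\<psi> x = 0")
      case False
      then have pos: "0 < u x" using \<psi>(2) x by simp
      have "((\<lambda>s. s powr m) has_real_derivative m * u x powr (m - 1)) (at (u x))"
        using pos by (rule has_real_derivative_powr)
      then have "(?h has_real_derivative m * u x powr (m - 1)) (at (u x))"
        by (rule has_field_derivative_transform_within_open[of _ _ _ "{0<..}"]) (use pos in auto)
      then have "(?h has_derivative (\<lambda>k. k \<bullet> (m * u x powr (m - 1)))) (at (u x))"
        by (simp add: has_field_derivative_def mult.commute[of _ "m * u x powr (m - 1)"])
      from directional_quotient_tendsto[OF this, of "\<psi> x"] show ?thesis
        by (simp add: mult.commute)
    qed simp
  qed
  have 4: "AE x in lebesgue_on S. \<bar>f x\<bar> \<le> K" using f(2) by (intro AE_I2) simp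
  show "integrable (lebesgue_on S) (\<lambda>x. f x * (m * u x powr (m - 1) * \<psi> x))"
    and "(\<lambda>n. \<integral>x. f x * ((?h (u x + inverse (real (Suc n)) * \<psi> x) - ?h (u x)) * real (Suc n)) \<partial>lebesgue_on S)
      \<longlonglongrightarrow> (\<integral>x. f x * (m * u x powr (m - 1) * \<psi> x) \<partial>lebesgue_on S)"
    using first_variation_convex_integrand[OF S' 1 2 3 f(1) 4] by simp_all
qed

text \<open>
  The smallness condition on \<open>\<psi>\<close> says that \<open>u + t \<psi>\<close> stays positive wherever \<open>\<psi> \<noteq> 0\<close>, for
  all \<open>\<bar>t\<bar> \<le> 1\<close>; then the \<open>Q\<close> term cancels in the difference of the energies, and the two convex
  terms can be treated separately.
\<close>

lemma energy_first_variation: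
  fixes \<Omega> :: "'a::euclidean_space set"
  assumes \<Omega>: "open \<Omega>" "bounded \<Omega>"
    and F: "\<And>x z \<xi>. x \<in> \<Omega> \<Longrightarrow> F x z \<xi> = G x \<xi> + (f x * max z 0 powr m + Q x * indicator {0<..} z)"
    and G_meas: "\<And>\<xi>. (\<lambda>x. G x \<xi>) \<in> borel_measurable (lebesgue_on \<Omega>)"
    and convex: "AE x in lebesgue_on \<Omega>. convex_on UNIV (G x) \<and> (\<forall>\<xi>. G x differentiable (at \<xi>))"
    and growth: "\<And>x \<xi>. x \<in> \<Omega> \<Longrightarrow> 0 \<le> G x \<xi> \<and> G x \<xi> \<le> C * norm \<xi> powr p"
    and m: "1 \<le> m" "m \<le> p"
    and f: "f \<in> borel_measurable (lebesgue_on \<Omega>)" "\<And>x. x \<in> \<Omega> \<Longrightarrow> \<bar>f x\<bar> \<le> K"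
    and Q: "Q \<in> borel_measurable (lebesgue_on \<Omega>)" "\<And>x. x \<in> \<Omega> \<Longrightarrow> \<bar>Q x\<bar> \<le> L"
    and u: "u \<in> W1p \<Omega> p"
    and \<psi>: "\<psi> \<in> test_functions \<Omega>" "\<And>x. \<psi> x \<noteq> 0 \<Longrightarrow> \<bar>\<psi> x\<bar> < u x"
  shows "(\<lambda>n. (energy \<Omega> F (\<lambda>x. u x + inverse (real (Suc n)) * \<psi> x) - energy \<Omega> F u) * real (Suc n))
    \<longlonglongrightarrow> (\<integral>x. grad \<psi> x \<bullet> grad (G x) (wgrad \<Omega> u x) \<partial>lebesgue_on \<Omega>)
       + (\<integral>x. f x * (m * u x powr (m - 1) * \<psi> x) \<partial>lebesgue_on \<Omega>)"
proof -
  let ?D = "wgrad \<Omega> u" and ?h = "\<lambda>s::real. max s 0 powr m"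
  define t where "t n = inverse (real (Suc n))" for n
  define v where "v n x = u x + t n * \<psi> x" for n x
  have S: "\<Omega> \<in> lmeasurable" using \<Omega> by (intro bounded_set_imp_lmeasurable) auto
  interpret finite_measure "lebesgue_on \<Omega>" by (rule finite_measure_lebesgue_on[OF S])
  have S': "\<Omega> \<in> sets lebesgue" using S by (rule fmeasurableD)
  have p: "0 < p" "0 \<le> p" using m by auto
  note T = test_functionsD[OF \<psi>(1)]
  have \<psi>_Lp: "in_Lp \<Omega> p \<psi>"
    by (rule in_Lp_compact_support[OF \<Omega>(1) T(2) smooth_imp_continuous[OF T(1)] T(4) p(1)])
  have grad_Lp: "in_Lp \<Omega> p (grad \<psi>)"
    by (rule in_Lp_compact_support[OF \<Omega>(1) T(2) smooth_imp_continuous_grad[OF T(1)] T(5) p(1)])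
  have \<psi>_pos: "0 < u x" if "\<psi> x \<noteq> 0" for x using \<psi>(2)[OF that] by linarith
  note G_var = gradient_energy_first_variation[OF S' G_meas convex growth p(2) W1p_D(3)[OF u] grad_Lp]
  note h_var = lower_order_first_variation[OF S m W1p_D(1)[OF u] \<psi>_Lp \<psi>_pos f]
  have cont: "AE x in lebesgue_on \<Omega>. continuous_on UNIV (G x)"
    using convex by eventually_elim
      (auto intro!: differentiable_imp_continuous_on simp: differentiable_on_def)
  have G_int: "integrable (lebesgue_on \<Omega>) (\<lambda>x. G x (wgrad \<Omega> w x))" if "w \<in> W1p \<Omega> p" for w
    by (rule integrable_growth_composition[OF S' G_meas cont _ W1p_D(3)[OF that], of C])
      (use growth in simp)
  have h_int: "integrable (lebesgue_on \<Omega>) (\<lambda>x. f x * ?h (w x))" if "w \<in> W1p \<Omega> p" for w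
  proof (rule Bochner_Integration.integrable_bound)
    have h: "integrable (lebesgue_on \<Omega>) (\<lambda>x. ?h (w x))"
      using m by (intro integrable_max_0_powr[OF S W1p_D(1)[OF that]]) auto
    then show "integrable (lebesgue_on \<Omega>) (\<lambda>x. K * ?h (w x))" by simp
    show "(\<lambda>x. f x * ?h (w x)) \<in> borel_measurable (lebesgue_on \<Omega>)"
      by (rule borel_measurable_times[OF f(1) borel_measurable_integrable[OF h]])
    show "AE x in lebesgue_on \<Omega>. norm (f x * ?h (w x)) \<le> norm (K * ?h (w x))"
      using f(2) by (intro AE_I2) (fastforce simp: abs_mult intro!: mult_right_mono)
  qed
  have Q_int: "integrable (lebesgue_on \<Omega>) (\<lambda>x. Q x * indicator {0<..} (w x))" if "w \<in> W1p \<Omega> p" for w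
  proof (rule integrable_const_bound[of _ L])
    have [measurable]: "w \<in> borel_measurable (lebesgue_on \<Omega>)"
      using W1p_D(1)[OF that] by (simp add: in_Lp_def)
    note Q(1)[measurable]
    show "(\<lambda>x. Q x * indicator {0<..} (w x)) \<in> borel_measurable (lebesgue_on \<Omega>)" by measurable
    show "AE x in lebesgue_on \<Omega>. norm (Q x * indicator {0<..} (w x)) \<le> L"
      using Q(2) by (intro AE_I2) (fastforce simp: indicator_def intro: order_trans[OF abs_ge_zero])
  qed
  have energy: "energy \<Omega> F w = (\<integral>x. G x (wgrad \<Omega> w x) \<partial>lebesgue_on \<Omega>) +
      ((\<integral>x. f x * ?h (w x) \<partial>lebesgue_on \<Omega>) + (\<integral>x. Q x * indicator {0<..} (w x) \<partial>lebesgue_on \<Omega>))"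
    if "w \<in> W1p \<Omega> p" for w
  proof -
    have "energy \<Omega> F w
        = (\<integral>x. G x (wgrad \<Omega> w x) + (f x * ?h (w x) + Q x * indicator {0<..} (w x)) \<partial>lebesgue_on \<Omega>)"
      unfolding energy_def by (rule Bochner_Integration.integral_cong) (auto simp: F)
    then show ?thesis using G_int[OF that] h_int[OF that] Q_int[OF that] by simp
  qed
  have t\<psi>: "(\<lambda>x. t n * \<psi> x) \<in> test_functions \<Omega>" for n by (rule test_functions_cmult[OF \<psi>(1)])
  have v: "v n \<in> W1p \<Omega> p" for n
    unfolding v_def by (rule W1p_add_test_function[OF \<Omega>(1) u t\<psi> p(1)])
  \<comment> \<open>The representative chosen by \<^const>\<open>wgrad\<close> agrees with the expected one almost everywhere.\<close>
  have "(\<integral>x. G x (wgrad \<Omega> (v n) x) \<partial>lebesgue_on \<Omega>)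
      = (\<integral>x. G x (?D x + t n *\<^sub>R grad \<psi> x) \<partial>lebesgue_on \<Omega>)" for n
  proof (rule integral_cong_AE)
    show "(\<lambda>x. G x (wgrad \<Omega> (v n) x)) \<in> borel_measurable (lebesgue_on \<Omega>)"
      using G_int[OF v] by (rule borel_measurable_integrable)
    show "(\<lambda>x. G x (?D x + t n *\<^sub>R grad \<psi> x)) \<in> borel_measurable (lebesgue_on \<Omega>)"
      using G_var(1) by (rule borel_measurable_integrable)
    have "grad (\<lambda>x. t n * \<psi> x) x = t n *\<^sub>R grad \<psi> x" for x
      by (rule grad_cmult[OF smooth_imp_differentiable[OF T(1)]])
    with wgrad_add_test_function[OF \<Omega>(1) W1p_D(2)[OF u] t\<psi>[of n]]
    show "AE x in lebesgue_on \<Omega>. G x (wgrad \<Omega> (v n) x) = G x (?D x + t n *\<^sub>R grad \<psi> x)"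
      unfolding v_def by (auto elim: eventually_mono)
  qed
  moreover have "indicator {0<..} (v n x) = (indicator {0<..} (u x) :: real)" for n x
  proof (cases "\<psi> x = 0")
    case False
    have "\<bar>t n * \<psi> x\<bar> \<le> \<bar>\<psi> x\<bar>"
      by (simp add: t_def abs_mult mult_left_le_one_le inverse_le_1_iff)
    with \<psi>(2)[OF False] have "0 < u x" "0 < v n x" unfolding v_def by linarith+
    then show ?thesis by simp
  qed (simp add: v_def)
  ultimately have "(energy \<Omega> F (v n) - energy \<Omega> F u) * real (Suc n) =
      ((\<integral>x. G x (?D x + t n *\<^sub>R grad \<psi> x) \<partial>lebesgue_on \<Omega>)
          - (\<integral>x. G x (?D x) \<partial>lebesgue_on \<Omega>)) * real (Suc n) +
      ((\<integral>x. f x * ?h (v n x) \<partial>lebesgue_on \<Omega>)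
          - (\<integral>x. f x * ?h (u x) \<partial>lebesgue_on \<Omega>)) * real (Suc n)" for n
    unfolding energy[OF v] energy[OF u] by (simp add: algebra_simps)
  also have "((\<integral>x. G x (?D x + t n *\<^sub>R grad \<psi> x) \<partial>lebesgue_on \<Omega>)
      - (\<integral>x. G x (?D x) \<partial>lebesgue_on \<Omega>)) * real (Suc n)
      = (\<integral>x. (G x (?D x + t n *\<^sub>R grad \<psi> x) - G x (?D x)) * real (Suc n) \<partial>lebesgue_on \<Omega>)" for n
    using G_var(1)[of "t n"] G_int[OF u] by simp
  also have "((\<integral>x. f x * ?h (v n x) \<partial>lebesgue_on \<Omega>)
      - (\<integral>x. f x * ?h (u x) \<partial>lebesgue_on \<Omega>)) * real (Suc n)
      = (\<integral>x. f x * ((?h (v n x) - ?h (u x)) * real (Suc n)) \<partial>lebesgue_on \<Omega>)" for n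
  proof -
    have distrib: "(\<lambda>x. f x * ((?h (v n x) - ?h (u x)) * real (Suc n))) =
        (\<lambda>x. (f x * ?h (v n x) - f x * ?h (u x)) * real (Suc n))"
      by (simp add: algebra_simps del: of_nat_Suc)
    show ?thesis
      unfolding distrib using h_int[OF v] h_int[OF u] by (simp del: of_nat_Suc)
  qed
  finally have quotient: "(energy \<Omega> F (v n) - energy \<Omega> F u) * real (Suc n) =
    (\<integral>x. (G x (?D x + t n *\<^sub>R grad \<psi> x) - G x (?D x)) * real (Suc n) \<partial>lebesgue_on \<Omega>) +
    (\<integral>x. f x * ((?h (v n x) - ?h (u x)) * real (Suc n)) \<partial>lebesgue_on \<Omega>)" for n .
  show ?thesis
    using tendsto_add[OF G_var(3) h_var(2)] quotient
    unfolding v_def t_def by simp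
qed

lemma hoelder_on_imp_continuous_on:
  assumes "hoelder_on \<beta> S Q" "0 < \<beta>"
  shows "continuous_on S Q"
  unfolding continuous_on_def
proof
  fix x assume x: "x \<in> S"
  obtain C where C: "\<And>x y. x \<in> S \<Longrightarrow> y \<in> S \<Longrightarrow> \<bar>Q x - Q y\<bar> \<le> C * dist x y powr \<beta>"
    using assms(1) by (auto simp: hoelder_on_def)
  have "((\<lambda>y. dist y x powr \<beta>) \<longlongrightarrow> 0) (at x within S)"
    using assms(2) by (intro tendsto_zero_powrI[where b
        = \<beta>] tendsto_dist_iff[THEN iffD1] tendsto_ident_at) auto
  then have "((\<lambda>y. C * dist y x powr \<beta>) \<longlongrightarrow> 0) (at x within S)"
    by (rule tendsto_mult_right_zero)
  then have "((\<lambda>y. Q y - Q x) \<longlongrightarrow> 0) (at x within S)"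
    by (rule Lim_null_comparison[rotated])
      (use C x in \<open>auto simp: eventually_at_filter intro!: always_eventually\<close>)
  then show "(Q \<longlongrightarrow> Q x) (at x within S)" by (rule Lim_null[THEN iffD2])
qed

theorem theorem2p4:
  fixes \<Omega> :: "(real ^ 'n) set"
    and p m lam K \<beta> \<epsilon> :: real
    and \<phi> u f Q :: "real ^ 'n \<Rightarrow> real"
    and F :: "real ^ 'n \<Rightarrow> real \<Rightarrow> real ^ 'n \<Rightarrow> real"
    and G :: "real ^ 'n \<Rightarrow> real ^ 'n \<Rightarrow> real"
    and g :: "real ^ 'n \<Rightarrow> real \<Rightarrow> real"
  assumes dom: "bounded_smooth_domain \<Omega>"
    and p: "2 \<le> p" "p < real CARD('n)"
    and \<phi>: "\<phi> \<in> W1p \<Omega> p" "\<exists>M. AE X in lebesgue_on \<Omega>. 0 \<le> \<phi> X \<and> \<phi> X \<le> M"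
    and F: "\<And>X z \<xi>. X \<in> \<Omega> \<Longrightarrow> F X z \<xi> = G X \<xi> + g X z"
    and G_cont: "\<And>\<xi>. continuous_on \<Omega> (\<lambda>X. G X \<xi>)"
    and lam: "0 < lam"
    and G_growth: "\<And>X \<xi>. X \<in> \<Omega> \<Longrightarrow>
          lam * norm \<xi> powr p \<le> G X \<xi> \<and> G X \<xi> \<le> inverse lam * norm \<xi> powr p"
    and G_convex: "AE X in lebesgue_on \<Omega>. strictly_convex (G X) \<and>
          (\<forall>\<xi>. G X differentiable (at \<xi>)) \<and>
          (\<forall>t \<xi>. G X (t *\<^sub>R \<xi>) = \<bar>t\<bar> powr p * G X \<xi>)"
    and g: "\<And>X z. X \<in> \<Omega> \<Longrightarrow> g X z = f X * (max z 0) powr m + Q X * indicator {0<..} z"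
    and m: "1 \<le> m" "m < p"
    and f: "f \<in> borel_measurable (lebesgue_on \<Omega>)" "0 < K" "\<And>X. X \<in> \<Omega> \<Longrightarrow> - K \<le> f X \<and> f X \<le> K"
    and Q: "0 < \<beta>" "\<beta> \<le> 1" "hoelder_on \<beta> \<Omega> Q"
    and \<epsilon>: "0 < \<epsilon>" "\<And>X. X \<in> \<Omega> \<Longrightarrow> \<epsilon> < Q X \<and> Q X < inverse \<epsilon>"
    and u: "is_minimizer \<Omega> p \<phi> F u" "continuous_on \<Omega> u"
  shows "distributional_div {X \<in> \<Omega>. u X > 0}
           (\<lambda>X. grad (G X) (wgrad \<Omega> u X)) (\<lambda>X. m * f X * u X powr (m - 1))"
proof -
  let ?U = "{X \<in> \<Omega>. u X > 0}" and ?V = "\<lambda>X. grad (G X) (wgrad \<Omega> u X)"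
  have \<Omega>: "open \<Omega>" "bounded \<Omega>" using dom by (auto simp: bounded_smooth_domain_def)
  have S: "\<Omega> \<in> lmeasurable" using \<Omega> by (intro bounded_set_imp_lmeasurable) auto
  have S': "\<Omega> \<in> sets lebesgue" using S by (rule fmeasurableD)
  have U: "open ?U" "?U \<subseteq> \<Omega>"
    using continuous_open_preimage[OF u(2) \<Omega>(1) open_greaterThan[of 0]]
    by (auto simp: vimage_def Collect_conj_eq)
  have p0: "0 < p" "0 \<le> p" using p(1) by auto
  have uW: "u \<in> W1p_bdry \<Omega> p \<phi>" "u \<in> W1p \<Omega> p"
    using u(1) by (auto simp: is_minimizer_def W1p_bdry_def)
  have G_meas: "(\<lambda>X. G X \<xi>) \<in> borel_measurable (lebesgue_on \<Omega>)" for \<xi>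
    by (rule continuous_imp_measurable_on_sets_lebesgue[OF G_cont S'])
  have growth: "0 \<le> G X \<xi> \<and> G X \<xi> \<le> inverse lam * norm \<xi> powr p" if "X \<in> \<Omega>" for X \<xi>
    using G_growth[OF that, of \<xi>] lam by (auto intro: order_trans[rotated])
  have convex: "AE X in lebesgue_on \<Omega>. convex_on UNIV (G X) \<and> (\<forall>\<xi>. G X differentiable (at \<xi>))"
    using G_convex by eventually_elim (auto intro: strictly_convex_imp_convex_on)
  have f': "\<bar>f X\<bar> \<le> K" if "X \<in> \<Omega>" for X using f(3)[OF that] by auto
  have Q': "Q \<in> borel_measurable (lebesgue_on \<Omega>)" "\<And>X. X \<in> \<Omega> \<Longrightarrow> \<bar>Q X\<bar> \<le> inverse \<epsilon>"
  proof -
    show "Q \<in> borel_measurable (lebesgue_on \<Omega>)"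
      by (rule continuous_imp_measurable_on_sets_lebesgue[OF hoelder_on_imp_continuous_on[OF Q(3,1)] S'])
    show "\<bar>Q X\<bar> \<le> inverse \<epsilon>" if "X \<in> \<Omega>" for X using \<epsilon>(1) \<epsilon>(2)[OF that] by linarith
  qed
  have V_int: "integrable (lebesgue_on \<Omega>) ?V"
    by (rule integrable_grad_composition[OF S G_meas convex growth p0(2) W1p_D(3)[OF uW(2)]])

  \<comment> \<open>Minimality along the admissible perturbations with a small test function.\<close>
  have nonneg: "0 \<le> (\<integral>X. grad \<psi> X \<bullet> ?V X \<partial>lebesgue_on \<Omega>)
       + (\<integral>X. f X * (m * u X powr (m - 1) * \<psi> X) \<partial>lebesgue_on \<Omega>)"
    if \<psi>: "\<psi> \<in> test_functions \<Omega>" "\<And>X. \<psi> X \<noteq> 0 \<Longrightarrow> \<bar>\<psi> X\<bar> < u X" for \<psi>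
  proof (rule LIMSEQ_le_const[OF energy_first_variation[OF \<Omega> _ G_meas convex growth m(1) less_imp_le[OF m(2)]
          f(1) f' Q' uW(2) \<psi>]])
    show "F X z \<xi> = G X \<xi> + (f X * max z 0 powr m + Q X * indicator {0<..} z)" if "X \<in> \<Omega>" for X z \<xi>
      using F[OF that] g[OF that] by simp
    have "0 \<le> energy \<Omega> F (\<lambda>x. u x + inverse (real (Suc n)) * \<psi> x) - energy \<Omega> F u" for n
      using u(1) W1p_bdry_add_test_function[OF \<Omega>(1) uW(1) test_functions_cmult[OF \<psi>(1)] p0(1)]
      by (auto simp: is_minimizer_def)
    then show "\<exists>N. \<forall>n\<ge>N. 0
        \<le> (energy \<Omega> F (\<lambda>x. u x + inverse (real (Suc n)) * \<psi> x) - energy \<Omega> F u) * real (Suc n)"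
      by (intro exI allI impI mult_nonneg_nonneg) auto
  qed

  show ?thesis
    unfolding distributional_div_def
  proof (intro conjI ballI)
    show "locally_integrable ?U ?V"
      by (rule integrable_imp_locally_integrable[OF S' V_int U(2)])
    show "locally_integrable ?U (\<lambda>X. m * f X * u X powr (m - 1))"
      unfolding locally_integrable_def
    proof (intro allI impI)
      fix C assume C: "compact C \<and> C \<subseteq> ?U"
      have cont: "continuous_on C (\<lambda>X. m * u X powr (m - 1))"
        using C by (intro continuous_intros continuous_on_subset[OF u(2)]) auto
      have C_meas: "C \<in> lmeasurable" using C by (simp add: lmeasurable_compact)
      have f_C: "f absolutely_integrable_on C"
      proof (rule measurable_bounded_by_integrable_imp_absolutely_integrable)
        show "f \<in> borel_measurable (lebesgue_on C)"
          using C U(2) by (intro measurable_restrict_mono[OF f(1)]) blast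
        show "C \<in> sets lebesgue" using C_meas by (rule fmeasurableD)
        show "(\<lambda>X. K) integrable_on C" using C_meas by (rule integrable_on_const)
        show "norm (f X) \<le> K" if "X \<in> C" for X using C that f'[of X] by auto
      qed
      have "(\<lambda>X. (m * u X powr (m - 1)) * f X) absolutely_integrable_on C"
      proof (rule absolutely_integrable_bounded_measurable_product[where h = "(*)" and g
          = f, OF bilinear_times])
        show "C \<in> sets lebesgue" using C_meas by (rule fmeasurableD)
        then show "(\<lambda>X. m * u X powr (m - 1)) \<in> borel_measurable (lebesgue_on C)"
          by (rule continuous_imp_measurable_on_sets_lebesgue[OF cont])
        show "bounded ((\<lambda>X. m * u X powr (m - 1)) ` C)"
          using C by (intro compact_imp_bounded compact_continuous_image cont) simp
      qed (rule f_C)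
      then show "(\<lambda>X. m * f X * u X powr (m - 1)) absolutely_integrable_on C"
        by (simp add: mult_ac)
    qed
    fix \<psi> assume \<psi>: "\<psi> \<in> test_functions ?U"
    note T = test_functionsD[OF \<psi>]
    let ?K = "closure {X. \<psi> X \<noteq> 0}"
    let ?I1 = "\<integral>X. grad \<psi> X \<bullet> ?V X \<partial>lebesgue_on \<Omega>"
      and ?I2 = "\<integral>X. f X * (m * u X powr (m - 1) * \<psi> X) \<partial>lebesgue_on \<Omega>"
    have \<psi>\<Omega>: "\<psi> \<in> test_functions \<Omega>" using \<psi> test_functions_mono[OF U(2)] by blast
    obtain c where c: "0 < c" "\<And>X. X \<in> ?K \<Longrightarrow> c \<le> u X"
    proof (cases "?K = {}")
      case True
      show thesis by (rule that[of 1]) (simp_all only: True empty_iff zero_less_one)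
    next
      case False
      have "continuous_on ?K u" using u(2) by (rule continuous_on_subset) (use T(3) in blast)
      from continuous_attains_inf[OF T(2) False this] obtain X0
        where "X0 \<in> ?K" "\<forall>X\<in>?K. u X0 \<le> u X" by (elim bexE)
      show thesis
      proof (rule that[of "u X0"])
        show "0 < u X0" using subsetD[OF T(3) \<open>X0 \<in> ?K\<close>] by simp
        show "u X0 \<le> u X" if "X \<in> ?K" for X using \<open>\<forall>X\<in>?K. u X0 \<le> u X\<close> that by (rule bspec)
      qed
    qed
    have "bounded (\<psi> ` ?K)"
      by (intro compact_imp_bounded compact_continuous_image smooth_imp_continuous T(1,2))
    then obtain B where B: "0 < B" "\<And>X. X \<in> ?K \<Longrightarrow> \<bar>\<psi> X\<bar> \<le> B"
      unfolding bounded_pos by (metis imageI real_norm_def)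
    \<comment> \<open>Both \<open>\<delta> \<psi>\<close> and \<open>- \<delta> \<psi>\<close> are small enough, being bounded by \<open>c / 2\<close> while \<open>u \<ge> c\<close> on the support.\<close>
    define \<delta> where "\<delta> = c / (2 * B)"
    have \<delta>: "0 < \<delta>" using c B by (simp add: \<delta>_def)
    have small: "\<bar>s * \<psi> X\<bar> < u X" if "\<bar>s\<bar> = \<delta>" "s * \<psi> X \<noteq> 0" for s X
    proof -
      have X: "X \<in> ?K" using that(2) closure_subset[of "{X. \<psi> X \<noteq> 0}"] by auto
      then have "\<bar>s * \<psi> X\<bar> \<le> \<delta> * B" using that(1) B(2)[of X] \<delta> by (simp add: abs_mult mult_left_mono)
      also have "\<dots> < c" using B c by (simp add: \<delta>_def)
      also have "\<dots> \<le> u X" by (rule c(2)[OF X])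
      finally show ?thesis .
    qed
    have scaled: "0 \<le> s * (?I1 + ?I2)" if "\<bar>s\<bar> = \<delta>" for s
    proof -
      have "0 \<le> (\<integral>X. grad (\<lambda>X. s * \<psi> X) X \<bullet> ?V X \<partial>lebesgue_on \<Omega>)
       + (\<integral>X. f X * (m * u X powr (m - 1) * (s * \<psi> X)) \<partial>lebesgue_on \<Omega>)"
        using small[OF that] by (intro nonneg test_functions_cmult[OF \<psi>\<Omega>]) auto
      moreover have "grad (\<lambda>X. s * \<psi> X) X \<bullet> ?V X = s * (grad \<psi> X \<bullet> ?V X)" for X
        by (simp add: grad_cmult[OF smooth_imp_differentiable[OF T(1)]])
      moreover have "f X * (m * u X powr (m - 1) * (s * \<psi> X))
          = s * (f X * (m * u X powr (m - 1) * \<psi> X))" for X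
        by simp
      ultimately show ?thesis by (simp add: distrib_left)
    qed
    have "?I1 + ?I2 = 0"
      using scaled[of \<delta>] scaled[of "- \<delta>"] \<delta> by (simp add: zero_le_mult_iff mult_le_0_iff)
    have outside: "\<psi> X = 0" "grad \<psi> X = 0" if "X \<notin> ?U" for X
      using that T(3) by (blast intro: T(4) T(5))+
    have "(\<integral>X. ?V X \<bullet> grad \<psi> X \<partial>lebesgue_on ?U) = ?I1"
      using U \<Omega>(1) outside
      by (subst (1 2) integral_lebesgue_on_eq_lebesgue(2)) (auto simp: inner_commute)
    moreover have "(\<integral>X. m * f X * u X powr (m - 1) * \<psi> X \<partial>lebesgue_on ?U) = ?I2"
      using U \<Omega>(1) outside
      by (subst (1 2) integral_lebesgue_on_eq_lebesgue(2)) (auto simp: mult_ac)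
    ultimately show "- (\<integral>X. ?V X \<bullet> grad \<psi> X \<partial>lebesgue_on ?U)
        = (\<integral>X. m * f X * u X powr (m - 1) * \<psi> X \<partial>lebesgue_on ?U)"
      using \<open>?I1 + ?I2 = 0\<close> by linarith
  qed
qed

end
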